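(* Let $C_w$ be a cell of $\mathcal{SG}$ with $C_w\cap V_0=\emptyset$ and boundary points $p_i=F_wq_i$, $i=0,1,2$. For every $(a_0,a_1,a_2)\in\mathbb{R}^3$ with $a_i\ge0$ and $a_0+a_1+a_2=1$ there exist $c_0,c_1,c_2\in[0,1]$ such that $$M_{B(c_0,c_1,c_2)}(h)=a_0h(p_0)+a_1h(p_1)+a_2h(p_2)$$ for every harmonic function $h$ on $\mathcal{SG}$.
   Context: Let $q_0,q_1,q_2$ be the vertices of an equilateral triangle in $\mathbb{R}^2$ and $F_i(z)=\frac12(z+q_i)$. The Sierpinski gasket $\mathcal{SG}$ is the unique nonempty compact set with $\mathcal{SG}=\bigcup_{i=0}^2F_i(\mathcal{SG})$. For $w\in\{0,1,2\}^m$, $F_w=F_{w_1}\circ\cdots\circ F_{w_m}$ and $C_w=F_w(\mathcal{SG})$ is an $m$-cell. $V_0=\{q_0,q_1,q_2\}$, $V_m=\bigcup_{|w|=m}F_w(V_0)$, and $x\sim_m y$ means $x\ne y$ lie in a common $F_w(V_0)$, $|w|=m$. $\mu$ is the self-similar probability measure giving mass $3^{-m}$ to each $m$-cell. A continuous $h:\mathcal{SG}\to\mathbb{R}$ is harmonic if $h(x)=\frac14\sum_{y\sim_mx}h(y)$ for all $m\ge1$, $x\in V_m\setminus V_0$. $M_B(h)=\frac1{\mu(B)}\int_Bh\,d\mu$. For $C_w$ as in the claim, $C_i$ denotes the unique other cell of the same level containing $p_i$, $\rho$ is the height of the triangle $F_w(\mathrm{conv}\,V_0)$, and for $c_i\in[0,1]$,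 with $u_i$ the unit vector at $p_i$ along the symmetry axis of the triangle of $C_i$ pointing into $C_i$, $E_i=\{z\in C_i:\langle z-p_i,u_i\rangle\le c_i\rho\}$ (the sub-triangle of $C_i$ cut off symmetrically by a line at distance $c_i\rho$ from $p_i$), and $B(c_0,c_1,c_2)=C_w\cup E_0\cup E_1\cup E_2$. *)

theory Defs
  imports "HOL-Analysis.Analysis" "HOL-Probability.Probability"
begin

text \<open>The plane R^2 is modelled by the type complex. q 0, q 1, q 2 are the vertices
  of the triangle; indices range over {0,1,2}.\<close>

definition SGmap :: "(nat \<Rightarrow> complex) \<Rightarrow> nat \<Rightarrow> complex \<Rightarrow> complex" where
  "SGmap q i z = (z + q i) / 2"

fun SGword :: "(nat \<Rightarrow> complex) \<Rightarrow> nat list \<Rightarrow> complex \<Rightarrow> complex" where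
  "SGword q [] = id"
| "SGword q (i # w) = SGmap q i \<circ> SGword q w"

definition words :: "nat \<Rightarrow> nat list set" where
  "words m = {w. length w = m \<and> set w \<subseteq> {0,1,2}}"

definition V0 :: "(nat \<Rightarrow> complex) \<Rightarrow> complex set" where
  "V0 q = q ` {0,1,2}"

definition Vm :: "(nat \<Rightarrow> complex) \<Rightarrow> nat \<Rightarrow> complex set" where
  "Vm q m = (\<Union>w\<in>words m. SGword q w ` V0 q)"

definition adj :: "(nat \<Rightarrow> complex) \<Rightarrow> nat \<Rightarrow> complex \<Rightarrow> complex \<Rightarrow> bool" where
  "adj q m x y \<longleftrightarrow> x \<noteq> y \<and>
     (\<exists>w\<in>words m. x \<in> SGword q w ` V0 q \<and> y \<in> SGword q w ` V0 q)"

definition is_SG :: "(nat \<Rightarrow> complex) \<Rightarrow> complex set \<Rightarrow> bool" where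
  "is_SG q K \<longleftrightarrow> compact K \<and> K \<noteq> {} \<and> K = (\<Union>i\<in>{0,1,2}. SGmap q i ` K)"

definition cell :: "(nat \<Rightarrow> complex) \<Rightarrow> complex set \<Rightarrow> nat list \<Rightarrow> complex set" where
  "cell q K w = SGword q w ` K"

definition is_SG_measure :: "(nat \<Rightarrow> complex) \<Rightarrow> complex set \<Rightarrow> complex measure \<Rightarrow> bool" where
  "is_SG_measure q K \<mu> \<longleftrightarrow> prob_space \<mu> \<and> sets \<mu> = sets borel \<and>
     (\<forall>w. set w \<subseteq> {0,1,2} \<longrightarrow> measure \<mu> (cell q K w) = 1 / 3 ^ length w)"

definition harmonic_SG :: "(nat \<Rightarrow> complex) \<Rightarrow> complex set \<Rightarrow> (complex \<Rightarrow> real) \<Rightarrow> bool" where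
  "harmonic_SG q K h \<longleftrightarrow> continuous_on K h \<and>
     (\<forall>m\<ge>1. \<forall>x\<in>Vm q m - V0 q. h x = (1/4) * (\<Sum>y\<in>{y. adj q m x y}. h y))"

definition mean_on :: "complex measure \<Rightarrow> complex set \<Rightarrow> (complex \<Rightarrow> real) \<Rightarrow> real" where
  "mean_on \<mu> B h = (LINT x:B|\<mu>. h x) / measure \<mu> B"

text \<open>Height of the equilateral triangle F_w(conv V_0).\<close>
definition cell_height :: "(nat \<Rightarrow> complex) \<Rightarrow> nat list \<Rightarrow> real" where
  "cell_height q w = sqrt 3 / 2 * dist (SGword q w (q 0)) (SGword q w (q 1))"

definition cell_centroid :: "(nat \<Rightarrow> complex) \<Rightarrow> nat list \<Rightarrow> complex" where
  "cell_centroid q u = (SGword q u (q 0) + SGword q u (q 1) + SGword q u (q 2)) / 3"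

text \<open>E_i: the part of the neighbouring cell C_u (containing p = F_w q_i) at distance
  at most t * rho from p along the unit symmetry axis u_i pointing into C_u.\<close>
definition Ecut :: "(nat \<Rightarrow> complex) \<Rightarrow> complex set \<Rightarrow> nat list \<Rightarrow> nat list \<Rightarrow> nat \<Rightarrow> real \<Rightarrow> complex set" where
  "Ecut q K w u i t =
     (let p = SGword q w (q i); e = sgn (cell_centroid q u - p)
      in {z \<in> cell q K u. inner (z - p) e \<le> t * cell_height q w})"

definition Bset :: "(nat \<Rightarrow> complex) \<Rightarrow> complex set \<Rightarrow> nat list \<Rightarrow> (nat \<Rightarrow> nat list) \<Rightarrow> (nat \<Rightarrow> real) \<Rightarrow> complex set" where
  "Bset q K w v c = cell q K w \<union> (\<Union>i\<in>{0,1,2}. Ecut q K w (v i) i (c i))"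

end

theory Submission
  imports Defs
begin

text \<open>
  A harmonic function obeys the 2/5-2/5-1/5 rule in every cell, hence its integral over a cell is the
  mass of the cell times the mean of the three vertex values. On a neighbouring cell cut off at
  height t above the vertex p_i only the average of the two far vertex values enters, by reflection
  symmetry, and harmonicity at p_i expresses that average through the values at p_0, p_1, p_2. So with
  mass 1 for C_w, E_i contributes (m_i + 3/2 b_i) h(p_i) - b_i/2 (h(p_0) + h(p_1) + h(p_2)), where m_i is
  the mass of E_i and b_i the integral over E_i of the harmonic function that vanishes at p_i and equals 1
  at the two far vertices. Both are continuous and increasing in the height.

  If a_k is the smallest weight, take c_k = 0. What remains are the two equations
  m_i + 3/2 b_i = (a_i - a_k) M and m_j + 3/2 b_j = (a_j - a_k) M, where M = 1 + m_i + m_j is the total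
  mass. Since m is a 1-Lipschitz function of m + 3/2 b, both can be solved for prescribed M, and the
  intermediate value theorem in M closes the system: at M = 2 / max (a_i - a_k) (a_j - a_k) the larger
  of the two cuts is a whole cell.
\<close>

section \<open>Balancing the weights\<close>

text \<open>In units of the mass of C_w, comparing the coefficients of h(p_i) turns the claim into
  a_i M = 1/3 + m_i + 3/2 b_i - (b_0 + b_1 + b_2)/2 for i = 0, 1, 2. The last bracket couples all
  three equations. Subtracting the equation of the smallest weight removes it, and that equation
  comes back from a_0 + a_1 + a_2 = 1. A cut is not a finite union of cells, so its integrals are
  limits over the cells of level n lying below the cutting line. What is lost in the limit lies on
  that line, which has measure zero. On whole cells the 2/5-2/5-1/5 rule is a recursion on triples
  of numbers. Hence b_i can be defined as a limit of finite sums, and no harmonic function with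
  prescribed boundary values has to be constructed. The gasket is given only as an invariant compact
  set; its position in the triangle and the way its cells meet are derived from a maximum principle
  for the three maps.\<close>

lemma cont_lip:
  fixes f :: "real \<Rightarrow> real"
  assumes "\<And>x y. x \<in> S \<Longrightarrow> y \<in> S \<Longrightarrow> \<bar>f x - f y\<bar> \<le> \<bar>x - y\<bar>"
  shows "continuous_on S f"
  unfolding continuous_on_iff dist_real_def using assms by (meson le_less_trans)

text \<open>\<open>A\<close> and \<open>B\<close> are the two larger weights minus the smallest one,
  so \<open>A + B \<le> 1\<close> is what is left of the weights summing to 1. The order
  \<open>B \<le> A\<close> keeps \<open>B * t\<close> within [0,2] whenever \<open>A * t\<close>
  is.\<close>

lemma balance_two:
  fixes m1 \<beta>1 m2 \<beta>2 :: "real \<Rightarrow> real"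
  assumes c1: "continuous_on {0..1} m1" "continuous_on {0..1} \<beta>1"
    and c2: "continuous_on {0..1} m2" "continuous_on {0..1} \<beta>2"
    and mono1: "mono_on {0..1} m1" "mono_on {0..1} \<beta>1"
    and mono2: "mono_on {0..1} m2" "mono_on {0..1} \<beta>2"
    and z: "m1 0 = 0" "\<beta>1 0 = 0" "m2 0 = 0" "\<beta>2 0 = 0"
    and one: "m1 1 = 1" "\<beta>1 1 = 2/3" "m2 1 = 1" "\<beta>2 1 = 2/3"
    and AB: "0 \<le> B" "B \<le> A" "A + B \<le> 1"
  shows "\<exists>x\<in>{0..1}. \<exists>y\<in>{0..1}. m1 x + 3/2 * \<beta>1 x = A * (1 + m1 x + m2 y) \<and>
    m2 y + 3/2 * \<beta>2 y = B * (1 + m1 x + m2 y)"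
proof (cases "A = 0")
  case True
  then show ?thesis using AB z by (intro bexI[of _ 0]) auto
next
  case False
  then have A: "A > 0" using AB by simp
  \<comment> \<open>The sum runs from 0 to 2 over [0,1]. It is only known to be weakly increasing,
    so \<open>X\<close> is a mere choice of preimages and may jump.\<close>
  have inv: "\<exists>X. \<forall>s\<in>{0..2}. X s \<in> {0..1} \<and> m (X s) + 3/2 * \<beta> (X s) = s"
    if "continuous_on {0..1} m" "continuous_on {0..1} \<beta>" "m 0 = 0" "\<beta> 0 = 0" "m 1 = 1" "\<beta> 1 = 2/3"
    for m \<beta> :: "real \<Rightarrow> real"
  proof (intro bchoice ballI)
    fix s :: real assume s: "s \<in> {0..2}"
    have "continuous_on {0..1} (\<lambda>x. m x + 3/2 * \<beta> x)" using that by (intro continuous_intros)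
    then show "\<exists>x. x \<in> {0..1} \<and> m x + 3/2 * \<beta> x = s"
      using IVT'[of "\<lambda>x. m x + 3/2 * \<beta> x" 0 s 1] s that by auto
  qed
  \<comment> \<open>Jumps of \<open>X\<close> do no harm: the increments of \<open>m\<close> and
    \<beta> have the same sign and add up, with factor 3/2 on the second, to \<open>s - t\<close>,
    so the increment of \<open>m\<close> alone is no larger than \<open>s - t\<close> in absolute
    value.\<close>
  have lip: "continuous_on {0..2} (\<lambda>s. m (X s))"
    if "mono_on {0..1} m" "mono_on {0..1} \<beta>"
      and X: "\<forall>s\<in>{0..2}. X s \<in> {0..1} \<and> m (X s) + 3/2 * \<beta> (X s) = s"
    for m \<beta> X :: "real \<Rightarrow> real"
  proof (rule cont_lip)
    fix s t :: real assume st: "s \<in> {0..2}" "t \<in> {0..2}"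
    have X': "X s \<in> {0..1}" "X t \<in> {0..1}" and e: "m (X s) + 3/2 * \<beta> (X s) = s" "m (X t) + 3/2 * \<beta> (X t) = t"
      using X st by auto
    consider "X s \<le> X t" | "X t \<le> X s" by linarith
    then show "\<bar>m (X s) - m (X t)\<bar> \<le> \<bar>s - t\<bar>"
    proof cases
      case 1
      then have "m (X s) \<le> m (X t)" "\<beta> (X s) \<le> \<beta> (X t)" using mono_onD[OF that(1)] mono_onD[OF that(2)] X' 1 by auto
      then show ?thesis using e by argo
    next
      case 2
      then have "m (X t) \<le> m (X s)" "\<beta> (X t) \<le> \<beta> (X s)" using mono_onD[OF that(1)] mono_onD[OF that(2)] X' 2 by auto
      then show ?thesis using e by argo
    qed
  qed
  obtain X where X: "\<forall>s\<in>{0..2}. X s \<in> {0..1} \<and> m1 (X s) + 3/2 * \<beta>1 (X s) = s"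
    using inv[OF c1 z(1,2) one(1,2)] by auto
  obtain Y where Y: "\<forall>s\<in>{0..2}. Y s \<in> {0..1} \<and> m2 (Y s) + 3/2 * \<beta>2 (Y s) = s"
    using inv[OF c2 z(3,4) one(3,4)] by auto
  \<comment> \<open>A zero \<open>t\<close> of \<open>G\<close> is a consistent total mass: the cuts
    solved for the prescribed value \<open>t\<close> do produce total mass \<open>t\<close>.\<close>
  define G where "G t = t - 1 - m1 (X (A * t)) - m2 (Y (B * t))" for t
  have At: "A * t \<in> {0..2}" if "t \<in> {0..2/A}" for t using that A by (auto simp: field_simps)
  have Bt: "B * t \<in> {0..2}" if "t \<in> {0..2/A}" for t
    using At[OF that] that AB mult_right_mono[of B A t] by auto
  have cont: "continuous_on {0..2/A} G"
    unfolding G_def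
    by (intro continuous_intros continuous_on_compose2[OF lip[OF mono1 X]]
        continuous_on_compose2[OF lip[OF mono2 Y]]) (use At Bt in auto)
  have nn: "0 \<le> m1 x" "m1 x \<le> 1" "0 \<le> \<beta>1 x" "0 \<le> m2 x" "0 \<le> \<beta>2 x" if "x \<in> {0..1}" for x
    using mono_onD[OF mono1(1), of 0 x] mono_onD[OF mono1(1), of x 1] mono_onD[OF mono1(2), of 0 x]
      mono_onD[OF mono2(1), of 0 x] mono_onD[OF mono2(2), of 0 x] that z one by auto
  have "G 0 \<le> 0" using nn(1)[of "X 0"] nn(4)[of "Y 0"] X Y by (auto simp: G_def)
  \<comment> \<open>Here \<open>A * t = 2\<close>. With \<open>m1 \<le> 1\<close> and
    \<open>m2 \<le> B * t\<close> the total mass is at most \<open>2 + 2 * B / A\<close>, and this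
    is at most \<open>2 / A\<close> precisely because \<open>A + B \<le> 1\<close>.\<close>
  moreover have "G (2/A) \<ge> 0"
  proof -
    have t: "2/A \<in> {0..2/A}" using A by auto
    have "m1 (X (A * (2/A))) \<le> 1" using nn(2) X At[OF t] by blast
    moreover have "m2 (Y (B * (2/A))) \<le> B * (2/A)"
      using Y Bt[OF t] nn(5)[of "Y (B * (2/A))"] by fastforce
    moreover have "B * (2/A) \<le> 2/A - 2" using A AB by (simp add: field_simps)
    ultimately show ?thesis unfolding G_def by linarith
  qed
  ultimately obtain t where t: "t \<in> {0..2/A}" "G t = 0"
    using IVT'[of G 0 0 "2/A"] cont A by auto
  have XY: "X (A * t) \<in> {0..1}" "Y (B * t) \<in> {0..1}" using X Y At Bt t by auto
  have e: "m1 (X (A * t)) + 3/2 * \<beta>1 (X (A * t)) = A * t" "m2 (Y (B * t)) + 3/2 * \<beta>2 (Y (B * t)) = B * t"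
    using X Y At Bt t by auto
  have t': "1 + m1 (X (A * t)) + m2 (Y (B * t)) = t" using t by (simp add: G_def)
  show ?thesis
    by (rule bexI[where x = "X (A * t)"], rule bexI[where x = "Y (B * t)"]) (use XY e in \<open>simp_all only: t' simp_thms\<close>)
qed

lemma balance_three:
  fixes m \<beta> :: "nat \<Rightarrow> real \<Rightarrow> real" and a :: "nat \<Rightarrow> real"
  assumes cont: "\<And>i. i \<in> {0,1,2} \<Longrightarrow> continuous_on {0..1} (m i)" "\<And>i. i \<in> {0,1,2} \<Longrightarrow> continuous_on {0..1} (\<beta> i)"
    and mono: "\<And>i. i \<in> {0,1,2} \<Longrightarrow> mono_on {0..1} (m i)" "\<And>i. i \<in> {0,1,2} \<Longrightarrow> mono_on {0..1} (\<beta> i)"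
    and z: "\<And>i. i \<in> {0,1,2} \<Longrightarrow> m i 0 = 0" "\<And>i. i \<in> {0,1,2} \<Longrightarrow> \<beta> i 0 = 0"
    and one: "\<And>i. i \<in> {0,1,2} \<Longrightarrow> m i 1 = 1" "\<And>i. i \<in> {0,1,2} \<Longrightarrow> \<beta> i 1 = 2/3"
    and a: "\<forall>i\<in>{0,1,2}. a i \<ge> 0" "a 0 + a 1 + a 2 = 1"
  shows "\<exists>c. (\<forall>i\<in>{0,1,2}. c i \<in> {0..1}) \<and> (\<forall>i\<in>{0,1,2}. a i * (1 + (\<Sum>j\<in>{0,1,2}. m j (c j))) =
    1/3 + m i (c i) + 3/2 * \<beta> i (c i) - (\<Sum>j\<in>{0,1,2}. \<beta> j (c j)) / 2)"
proof -
  \<comment> \<open>The system is invariant under permuting the indices, so the weights may be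
    sorted; \<open>k\<close> carries the smallest weight and receives the empty cut.\<close>
  define P where "P = (\<lambda>i j k. {i,j,k} = {0,1,2::nat} \<and> i \<noteq> j \<and> i \<noteq> k \<and> j \<noteq> k \<and> a k \<le> a j \<and> a j \<le> a i)"
  have "P 0 1 2 \<or> P 0 2 1 \<or> P 1 0 2 \<or> P 1 2 0 \<or> P 2 0 1 \<or> P 2 1 0"
    unfolding P_def by (simp add: insert_commute) linarith
  then obtain i j k where P: "P i j k" by blast
  have ijk: "{0,1,2} = {i,j,k}" "i \<noteq> j" "i \<noteq> k" "j \<noteq> k" "a k \<le> a j" "a j \<le> a i"
    using P by (auto simp: P_def)
  have s: "a i + a j + a k = 1" "0 \<le> a k"
  proof -
    have "(\<Sum>l\<in>{0,1,2}. a l) = 1" using a(2) by simp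
    then show "a i + a j + a k = 1" using ijk(2-4) unfolding ijk(1) by simp
    show "0 \<le> a k" using a(1) unfolding ijk(1) by simp
  qed
  have I: "i \<in> {0,1,2}" "j \<in> {0,1,2}" "k \<in> {0,1,2}" unfolding ijk(1) by auto
  obtain x y where xy: "x \<in> {0..1}" "y \<in> {0..1}"
    "m i x + 3/2 * \<beta> i x = (a i - a k) * (1 + m i x + m j y)"
    "m j y + 3/2 * \<beta> j y = (a j - a k) * (1 + m i x + m j y)"
    using balance_two[OF cont(1)[OF I(1)] cont(2)[OF I(1)] cont(1)[OF I(2)] cont(2)[OF I(2)]
      mono(1)[OF I(1)] mono(2)[OF I(1)] mono(1)[OF I(2)] mono(2)[OF I(2)]
      z(1)[OF I(1)] z(2)[OF I(1)] z(1)[OF I(2)] z(2)[OF I(2)]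
      one(1)[OF I(1)] one(2)[OF I(1)] one(1)[OF I(2)] one(2)[OF I(2)], of "a j - a k" "a i - a k"]
      ijk s by auto
  define c where "c = (\<lambda>l. if l = i then x else if l = j then y else 0)"
  have c: "c i = x" "c j = y" "c k = 0" using ijk by (auto simp: c_def)
  define M where "M = 1 + m i x + m j y"
  have M: "m i x + 3/2 * \<beta> i x = a i * M - a k * M" "m j y + 3/2 * \<beta> j y = a j * M - a k * M"
    using xy(3,4) unfolding M_def[symmetric] by (simp_all add: left_diff_distrib)
  have "a i * M + a j * M + a k * M = M" using s(1) by (simp add: distrib_right[symmetric])
  \<comment> \<open>Adding the two solved equations gives \<open>M - 3 * a k * M = (M - 1) + 3/2 *
    (\<beta> i x + \<beta> j y)\<close>, which is the missing equation for \<open>k\<close>.\<close>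
  then have k: "a k * M = 1/3 - (\<beta> i x + \<beta> j y) / 2"
    using M M_def unfolding add_divide_distrib by linarith
  then have eqs: "a i * M = 1/3 + m i x + 3/2 * \<beta> i x - (\<beta> i x + \<beta> j y) / 2"
    "a j * M = 1/3 + m j y + 3/2 * \<beta> j y - (\<beta> i x + \<beta> j y) / 2"
    using M by simp_all
  show ?thesis
  proof (intro exI[of _ c] conjI)
    show "\<forall>i\<in>{0,1,2}. c i \<in> {0..1}" unfolding ijk(1) using c xy by auto
    show "\<forall>i\<in>{0,1,2}. a i * (1 + (\<Sum>j\<in>{0,1,2}. m j (c j))) =
    1/3 + m i (c i) + 3/2 * \<beta> i (c i) - (\<Sum>j\<in>{0,1,2}. \<beta> j (c j)) / 2"
      unfolding ijk(1) using ijk(2-4) eqs k c z[OF I(3)] by (simp add: M_def add.assoc)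
  qed
qed

section \<open>Addresses and vertices of cells\<close>

lemma SGword_append: "SGword q (u @ v) z = SGword q u (SGword q v z)"
  by (induction u) auto

lemma SGword_diff: "SGword q w x - SGword q w y = (x - y) / 2 ^ length w"
proof (induction w)
  case (Cons a w)
  have "SGword q (a # w) x - SGword q (a # w) y = (SGword q w x - SGword q w y) / 2"
    by (simp add: SGmap_def add_divide_distrib diff_divide_distrib)
  then show ?case using Cons by simp
qed simp

lemma SGword_mid: "SGword q w ((x + y) / 2) = (SGword q w x + SGword q w y) / 2"
  by (induction w) (auto simp: SGmap_def add_divide_distrib)

lemma SGword_inject [simp]: "SGword q w x = SGword q w y \<longleftrightarrow> x = y"
proof -
  have "SGword q w x - SGword q w y = 0 \<longleftrightarrow> (x - y) / 2 ^ length w = 0"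
    by (simp only: SGword_diff)
  then show ?thesis by simp
qed

lemma continuous_SGword: "continuous_on S (SGword q w)"
  by (induction w arbitrary: S) (auto simp: SGmap_def comp_def intro!: continuous_intros)

lemma words_0 [simp]: "words 0 = {[]}"
  by (auto simp: words_def)

lemma words_Suc: "words (Suc n) = (\<Union>i\<in>{0,1,2}. (#) i ` words n)"
  by (auto simp: words_def length_Suc_conv image_iff)

lemma finite_words [simp]: "finite (words n)"
  by (induction n) (auto simp: words_Suc)

lemma sum_words_Suc:
  fixes f :: "nat list \<Rightarrow> real"
  shows "(\<Sum>v\<in>words (Suc n). f v) = (\<Sum>i\<in>{0,1,2}. \<Sum>v\<in>words n. f (i # v))"
  unfolding words_Suc by (subst sum.UNION_disjoint) (auto simp: sum.reindex)

lemma card_words: "card (words n) = 3 ^ n"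
proof -
  have "real (card (words n)) = 3 ^ n"
  proof (induction n)
    case (Suc n)
    have "real (card (words (Suc n))) = (\<Sum>v\<in>words (Suc n). 1)" by simp
    also have "\<dots> = 3 * real (card (words n))" by (simp only: sum_words_Suc) simp
    finally show ?case using Suc by simp
  qed simp
  then show ?thesis by (metis of_nat_eq_iff of_nat_numeral of_nat_power)
qed

section \<open>The equilateral triangle and the position of the gasket in it\<close>

text \<open>Up to scaling and a constant, \<open>inner (z - g) (a - g)\<close> is the barycentric
  coordinate of \<open>a\<close>: it takes the value s^2/3 at \<open>a\<close> and -s^2/6 at the two
  other vertices. The separation of cells is read off from these two constants.\<close>

lemma inner_centroid_equilateral:
  fixes a b c :: complex
  assumes "dist a b = s" "dist b c = s" "dist c a = s"
  defines "g \<equiv> (a + b + c) / 3"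
  shows "inner (a - g) (a - g) = s\<^sup>2 / 3" "inner (a - g) (b - g) = - (s\<^sup>2 / 6)"
proof -
  define x y where "x = a - b" and "y = a - c"
  have g: "a - g = (1/3) *\<^sub>R (x + y)" "b - g = (1/3) *\<^sub>R (y - 2 *\<^sub>R x)"
    by (simp_all add: g_def x_def y_def complex_eq_iff field_simps)
  have "norm x = s" "norm y = s" "norm (y - x) = s"
    using assms by (auto simp: x_def y_def dist_norm norm_minus_commute)
  then have xx: "inner x x = s\<^sup>2" "inner y y = s\<^sup>2" "inner (y - x) (y - x) = s\<^sup>2"
    by (metis power2_norm_eq_inner)+
  then have xy: "inner x y = s\<^sup>2 / 2" "inner y x = s\<^sup>2 / 2"
    by (simp_all add: inner_diff_left inner_diff_right inner_commute)
  show "inner (a - g) (a - g) = s\<^sup>2 / 3"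
    unfolding g inner_simps distrib_left right_diff_distrib xx xy by simp
  show "inner (a - g) (b - g) = - (s\<^sup>2 / 6)"
    unfolding g inner_simps distrib_left right_diff_distrib xx xy by simp
qed

locale gasket =
  fixes q :: "nat \<Rightarrow> complex" and K :: "complex set"
  assumes q01: "q 0 \<noteq> q 1" and q12: "dist (q 0) (q 1) = dist (q 1) (q 2)"
    and q20: "dist (q 1) (q 2) = dist (q 2) (q 0)"
    and SG: "is_SG q K"
begin

definition side :: real where "side = dist (q 0) (q 1)"

definition ctr :: complex where "ctr = (q 0 + q 1 + q 2) / 3"

lemma side_pos: "side > 0"
  using q01 by (simp add: side_def)

lemma side_sq_pos: "side\<^sup>2 > 0"
  using side_pos by simp

lemma dist_q: "i \<in> {0,1,2} \<Longrightarrow> j \<in> {0,1,2} \<Longrightarrow> i \<noteq> j \<Longrightarrow> dist (q i) (q j) = side"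
  using q12 q20 by (auto simp: side_def dist_commute)

lemma q_inj: "i \<in> {0,1,2} \<Longrightarrow> j \<in> {0,1,2} \<Longrightarrow> q i = q j \<longleftrightarrow> i = j"
  using dist_q[of i j] side_pos by auto

lemma inner_q:
  assumes "i \<in> {0,1,2}" "j \<in> {0,1,2}"
  shows "inner (q i - ctr) (q j - ctr) = (if i = j then side\<^sup>2 / 3 else - (side\<^sup>2 / 6))"
proof -
  have *: "inner (q i - ctr) (q i - ctr) = side\<^sup>2 / 3 \<and> inner (q i - ctr) (q j - ctr) = - (side\<^sup>2 / 6)"
    if "i \<in> {0,1,2}" "j \<in> {0,1,2}" "k \<in> {0,1,2}" "i \<noteq> j" "j \<noteq> k" "k \<noteq> i" for i j k
  proof -
    have e: "ctr = (q i + q j + q k) / 3" using that by (auto simp: ctr_def)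
    show ?thesis unfolding e
      using inner_centroid_equilateral dist_q[OF that(1,2,4)] dist_q[OF that(2,3,5)] dist_q[OF that(3,1,6)] by blast
  qed
  show ?thesis using *[of 0 1 2] *[of 0 2 1] *[of 1 0 2] *[of 1 2 0] *[of 2 0 1] *[of 2 1 0] assms by auto
qed

lemma K_compact: "compact K" and K_ne: "K \<noteq> {}" and K_eq: "K = (\<Union>i\<in>{0,1,2}. SGmap q i ` K)"
  using SG unfolding is_SG_def by blast+

lemma SGmap_K: "i \<in> {0,1,2} \<Longrightarrow> z \<in> K \<Longrightarrow> SGmap q i z \<in> K"
  using K_eq by blast

lemma SGword_K: "set w \<subseteq> {0,1,2} \<Longrightarrow> z \<in> K \<Longrightarrow> SGword q w z \<in> K"
  by (induction w) (auto intro!: SGmap_K)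

lemma K_cases:
  assumes "z \<in> K" obtains i z' where "i \<in> {0,1,2}" "z' \<in> K" "z = SGmap q i z'"
  using assms K_eq by blast

text \<open>A maximum principle that replaces convex hulls: if \<phi> is maximal at
  \<open>x = F_i y\<close>, then \<open>\<phi> x \<le> (\<phi> x + M) / 2\<close>.\<close>

lemma bound_on_K:
  fixes \<phi> :: "complex \<Rightarrow> real"
  assumes "continuous_on K \<phi>"
    and "\<And>z i. z \<in> K \<Longrightarrow> i \<in> {0,1,2} \<Longrightarrow> \<phi> (SGmap q i z) \<le> (\<phi> z + \<phi> (q i)) / 2"
    and "\<And>i. i \<in> {0,1,2} \<Longrightarrow> \<phi> (q i) \<le> M" and "z \<in> K"
  shows "\<phi> z \<le> M"
proof -
  obtain x where x: "x \<in> K" "\<And>y. y \<in> K \<Longrightarrow> \<phi> y \<le> \<phi> x"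
    using continuous_attains_sup[OF K_compact K_ne assms(1)] by blast
  obtain i y where y: "i \<in> {0,1,2}" "y \<in> K" "x = SGmap q i y" using K_cases[OF x(1)] .
  have "\<phi> x \<le> (\<phi> y + \<phi> (q i)) / 2" using assms(2) y by blast
  then have "\<phi> x \<le> M" using x(2)[OF y(2)] assms(3)[OF y(1)] unfolding add_divide_distrib by linarith
  then show ?thesis using x(2)[OF assms(4)] by linarith
qed

text \<open>The map F_i halves distances to its fixed point \<open>q i\<close>, so the point of
  \<open>K\<close> nearest to \<open>q i\<close> has distance 0.\<close>

lemma q_K: assumes "i \<in> {0,1,2}" shows "q i \<in> K"
proof -
  obtain z where z: "z \<in> K" "\<And>y. y \<in> K \<Longrightarrow> dist (q i) z \<le> dist (q i) y"
    using distance_attains_inf[OF compact_imp_closed[OF K_compact] K_ne, of "q i"] by blast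
  have "q i - SGmap q i z = (q i - z) / 2" by (simp add: SGmap_def field_simps)
  then have "norm (q i - SGmap q i z) = norm ((q i - z) / 2)" by (simp only:)
  then have "dist (q i) (SGmap q i z) = dist (q i) z / 2" by (simp add: dist_norm norm_divide)
  then have "dist (q i) z \<le> 0" using z(2)[OF SGmap_K[OF assms z(1)]] by linarith
  then show ?thesis using z by simp
qed

text \<open>This is the circumscribed disc; \<open>bound_on_K\<close> applies because the distance
  to the centroid is convex.\<close>

lemma norm_K: assumes "z \<in> K" shows "norm (z - ctr)^2 \<le> side\<^sup>2 / 3"
proof -
  have "norm (z - ctr) \<le> side / sqrt 3"
  proof (rule bound_on_K[OF _ _ _ assms])
    show "continuous_on K (\<lambda>z. norm (z - ctr))" by (intro continuous_intros)
    fix z i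
    have "SGmap q i z - ctr = ((z - ctr) + (q i - ctr)) / 2" by (simp add: SGmap_def field_simps)
    then have "norm (SGmap q i z - ctr) = norm (((z - ctr) + (q i - ctr)) / 2)" by (simp only:)
    then have "norm (SGmap q i z - ctr) = norm ((z - ctr) + (q i - ctr)) / 2" by (simp only: norm_divide) simp
    then show "norm (SGmap q i z - ctr) \<le> (norm (z - ctr) + norm (q i - ctr)) / 2"
      using norm_triangle_ineq[of "z - ctr" "q i - ctr"] by simp
  next
    fix i :: nat assume "i \<in> {0,1,2}"
    then have "norm (q i - ctr) ^ 2 = (side / sqrt 3)^2"
      using inner_q[of i i] by (simp add: power2_norm_eq_inner power_divide)
    then show "norm (q i - ctr) \<le> side / sqrt 3" using side_pos by (simp add: power2_eq_iff_nonneg)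
  qed
  then have "norm (z - ctr)^2 \<le> (side / sqrt 3)^2" by (intro power_mono) auto
  then show ?thesis by (simp add: power_divide)
qed

text \<open>The line where the functional of \<open>q i\<close> equals s^2/3 touches the
  circumscribed disc only at \<open>q i\<close>. Expanding the square of the distance from
  \<open>z\<close> to \<open>q i\<close> shows it.\<close>

lemma vertex_extreme:
  assumes "z \<in> K" "i \<in> {0,1,2}" "inner (z - ctr) (q i - ctr) \<ge> side\<^sup>2 / 3"
  shows "z = q i"
proof -
  have "norm ((z - ctr) - (q i - ctr))^2 = norm (z - ctr)^2 - 2 * inner (z - ctr) (q i - ctr) + norm (q i - ctr)^2"
    by (simp only: power2_norm_eq_inner) (simp add: inner_diff_left inner_diff_right inner_commute)
  also have "\<dots> \<le> 0"
    using norm_K[OF assms(1)] assms(3) inner_q[OF assms(2) assms(2)] by (simp add: power2_norm_eq_inner)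
  finally show ?thesis by simp
qed

lemma inner_SGmap: "inner (SGmap q j z - ctr) b = (inner (z - ctr) b + inner (q j - ctr) b) / 2"
proof -
  have "SGmap q j z - ctr = (1/2) *\<^sub>R ((z - ctr) + (q j - ctr))"
    by (simp add: SGmap_def field_simps scaleR_conv_of_real)
  then show ?thesis by (simp only: inner_scaleR_left inner_add_left)
qed

lemma inner_K:
  assumes "z \<in> K" "i \<in> {0,1,2}"
  shows "- (side\<^sup>2 / 6) \<le> inner (z - ctr) (q i - ctr)" "inner (z - ctr) (q i - ctr) \<le> side\<^sup>2 / 3"
proof -
  have v: "- (side\<^sup>2 / 6) \<le> inner (q j - ctr) (q i - ctr) \<and> inner (q j - ctr) (q i - ctr) \<le> side\<^sup>2 / 3"
    if "j \<in> {0,1,2}" for j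
  proof (cases "j = i")
    case True
    have "- (side\<^sup>2 / 6) \<le> side\<^sup>2 / 3" using side_sq_pos by linarith
    then show ?thesis using inner_q[OF that assms(2)] True by simp
  next
    case False
    have "- (side\<^sup>2 / 6) \<le> side\<^sup>2 / 3" using side_sq_pos by linarith
    then show ?thesis using inner_q[OF that assms(2)] unfolding if_not_P[OF False] by simp
  qed
  have "- inner (z - ctr) (q i - ctr) \<le> side\<^sup>2 / 6"
  proof (rule bound_on_K[OF _ _ _ assms(1)])
    show "continuous_on K (\<lambda>z. - inner (z - ctr) (q i - ctr))" by (intro continuous_intros)
    show "- inner (q j - ctr) (q i - ctr) \<le> side\<^sup>2 / 6" if "j \<in> {0,1,2}" for j
      using v[OF that] by linarith
  qed (unfold inner_SGmap add_divide_distrib, linarith)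
  then show "- (side\<^sup>2 / 6) \<le> inner (z - ctr) (q i - ctr)" by simp
  show "inner (z - ctr) (q i - ctr) \<le> side\<^sup>2 / 3"
  proof (rule bound_on_K[OF _ _ _ assms(1)])
    show "continuous_on K (\<lambda>z. inner (z - ctr) (q i - ctr))" by (intro continuous_intros)
  qed (use v in \<open>unfold inner_SGmap, auto simp del: insert_iff\<close>)
qed

section \<open>How cells of one level meet\<close>

text \<open>Apply the functional of \<open>q b\<close> to both sides: the value at \<open>z\<close>
  must exceed the value at \<open>z'\<close> by s^2/2. Since the latter is at least -s^2/6,
  \<open>z\<close> reaches the maximum s^2/3.\<close>

lemma SGmap_overlap:
  assumes "z \<in> K" "z' \<in> K" "a \<in> {0,1,2}" "b \<in> {0,1,2}" "a \<noteq> b" "SGmap q a z = SGmap q b z'"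
  shows "z = q b" 
proof -
  have "inner (z - ctr) (q b - ctr) + inner (q a - ctr) (q b - ctr)
      = inner (z' - ctr) (q b - ctr) + inner (q b - ctr) (q b - ctr)"
    using inner_SGmap[of a z "q b - ctr"] inner_SGmap[of b z' "q b - ctr"] assms(6) by simp
  then have "inner (z - ctr) (q b - ctr) = inner (z' - ctr) (q b - ctr) + side\<^sup>2 / 2"
    using inner_q[OF assms(3,4)] inner_q[OF assms(4,4)] assms(5) by simp
  then show ?thesis using inner_K(1)[OF assms(2,4)] by (intro vertex_extreme assms) auto
qed

text \<open>The functional of \<open>q b\<close> is maximal at \<open>q b\<close>, and a mean of two
  values is maximal only if both are. Hence the outermost letter is \<open>b\<close>, the inner
  point is again \<open>q b\<close>, and the argument repeats.\<close>

lemma SGword_eq_vertex: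
  assumes "set w \<subseteq> {0,1,2}" "z \<in> K" "b \<in> {0,1,2}" "SGword q w z = q b"
  shows "w = replicate (length w) b \<and> z = q b"
  using assms
proof (induction w)
  case (Cons a w)
  let ?y = "SGword q w z"
  have y: "?y \<in> K" using Cons.prems by (intro SGword_K) auto
  have a: "a \<in> {0,1,2}" using Cons.prems by auto
  have eq: "SGmap q a ?y = q b" using Cons.prems by simp
  have "2 * inner (q b - ctr) (q b - ctr) = inner (?y - ctr) (q b - ctr) + inner (q a - ctr) (q b - ctr)"
    using inner_SGmap[of a ?y "q b - ctr"] unfolding eq by simp
  then have "inner (?y - ctr) (q b - ctr) + inner (q a - ctr) (q b - ctr) = 2 * (side\<^sup>2 / 3)"
    using inner_q[OF Cons.prems(3) Cons.prems(3)] by simp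
  then have "inner (q a - ctr) (q b - ctr) \<ge> side\<^sup>2 / 3" using inner_K(2)[OF y Cons.prems(3)] by linarith
  then have ab: "a = b"
  proof (rule contrapos_pp)
    assume "a \<noteq> b"
    then have "inner (q a - ctr) (q b - ctr) = - (side\<^sup>2 / 6)"
      using inner_q[OF a Cons.prems(3)] by simp
    then show "\<not> side\<^sup>2 / 3 \<le> inner (q a - ctr) (q b - ctr)" using side_sq_pos by linarith
  qed
  have "?y + q a = 2 * q b" using eq by (simp add: SGmap_def)
  then have "?y = q b" using ab by simp
  then have "w = replicate (length w) b \<and> z = q b" using Cons.IH Cons.prems by simp
  then show ?case using ab by simp
qed simp

text \<open>At the first letter where the words differ, \<open>SGmap_overlap\<close> identifies the
  inner point as a vertex, and \<open>SGword_eq_vertex\<close> passes this down to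
  \<open>z\<close>.\<close>

lemma SGword_overlap_vertex:
  assumes "set w \<subseteq> {0,1,2}" "set u \<subseteq> {0,1,2}" "length w = length u" "w \<noteq> u"
    "z \<in> K" "z' \<in> K" "SGword q w z = SGword q u z'"
  shows "\<exists>i\<in>{0,1,2}. z = q i"
  using assms
proof (induction w arbitrary: u)
  case (Cons a w)
  then obtain b u' where u: "u = b # u'" by (cases u) auto
  have ab: "a \<in> {0,1,2}" "b \<in> {0,1,2}" "set w \<subseteq> {0,1,2}" "set u' \<subseteq> {0,1,2}" using Cons.prems u by auto
  show ?case
  proof (cases "a = b")
    case True
    then have "SGword q w z = SGword q u' z'" using Cons.prems(7) u by (simp add: SGmap_def)
    show ?thesis
      by (rule Cons.IH[OF ab(3,4) _ _ Cons.prems(5,6) \<open>SGword q w z = SGword q u' z'\<close>])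
        (use Cons.prems(3,4) u True in simp_all)
  next
    case False
    have "SGword q w z = q b"
      by (rule SGmap_overlap[OF SGword_K SGword_K ab(1,2) False, of w z u' z']) (use ab Cons.prems u in simp_all)
    then show ?thesis using SGword_eq_vertex[OF ab(3) Cons.prems(5) ab(2)] ab(2) by blast
  qed
qed simp

text \<open>Two cells of one level meet in at most one point, since \<open>SGmap_overlap\<close>
  names that point at the first differing letter. It yields null overlaps, disjoint neighbour sets
  and distinct neighbouring cells.\<close>

lemma SGword_overlap_unique:
  assumes "set w \<subseteq> {0,1,2}" "set u \<subseteq> {0,1,2}" "length w = length u" "w \<noteq> u"
    "x \<in> K" "x' \<in> K" "SGword q w x = SGword q u x'"
    "y \<in> K" "y' \<in> K" "SGword q w y = SGword q u y'"
  shows "x = y"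
  using assms
proof (induction w arbitrary: u)
  case (Cons a w)
  then obtain b u' where u: "u = b # u'" by (cases u) auto
  have ab: "a \<in> {0,1,2}" "b \<in> {0,1,2}" "set w \<subseteq> {0,1,2}" "set u' \<subseteq> {0,1,2}" using Cons.prems u by auto
  show ?case
  proof (cases "a = b")
    case True
    then have "SGword q w x = SGword q u' x'" "SGword q w y = SGword q u' y'" using Cons.prems(7,10) u by (simp_all add: SGmap_def)
    show ?thesis
      by (rule Cons.IH[OF ab(3,4) _ _ Cons.prems(5,6) \<open>SGword q w x = SGword q u' x'\<close>
            Cons.prems(8,9) \<open>SGword q w y = SGword q u' y'\<close>])
        (use Cons.prems(3,4) u True in simp_all)
  next
    case False
    have "SGword q w x = q b"
      by (rule SGmap_overlap[OF SGword_K SGword_K ab(1,2) False, of w x u' x']) (use ab Cons.prems u in simp_all)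
    moreover have "SGword q w y = q b"
      by (rule SGmap_overlap[OF SGword_K SGword_K ab(1,2) False, of w y u' y']) (use ab Cons.prems u in simp_all)
    ultimately show ?thesis by (metis SGword_inject)
  qed
qed simp

text \<open>No point lies in three cells of one level. Three distinct first letters would make one
  inner point equal to two vertices. If exactly two first letters agree, the inner points of those
  two cells are the same vertex, so both tails are constant words in the same letter and
  coincide.\<close>

lemma SGword_three:
  assumes "set w \<subseteq> {0,1,2}" "set u \<subseteq> {0,1,2}" "set t \<subseteq> {0,1,2}"
    "length w = n" "length u = n" "length t = n" "w \<noteq> u" "x \<in> K" "y \<in> K" "z \<in> K"
    "SGword q w x = SGword q u y" "SGword q w x = SGword q t z"
  shows "t = w \<or> t = u"
  using assms
proof (induction n arbitrary: w u t)
  case (Suc n)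
  obtain a w' where w: "w = a # w'" using Suc.prems by (cases w) auto
  obtain b u' where u: "u = b # u'" using Suc.prems by (cases u) auto
  obtain c t' where t: "t = c # t'" using Suc.prems by (cases t) auto
  have s: "a \<in> {0,1,2}" "b \<in> {0,1,2}" "c \<in> {0,1,2}" "set w' \<subseteq> {0,1,2}" "set u' \<subseteq> {0,1,2}" "set t' \<subseteq> {0,1,2}"
    using Suc.prems w u t by auto
  let ?x = "SGword q w' x" and ?y = "SGword q u' y" and ?z = "SGword q t' z"
  have k: "?x \<in> K" "?y \<in> K" "?z \<in> K" using s Suc.prems by (auto intro!: SGword_K)
  have e: "SGmap q a ?x = SGmap q b ?y" "SGmap q a ?x = SGmap q c ?z" using Suc.prems w u t by auto
  have ab: "a \<noteq> b \<Longrightarrow> ?x = q b \<and> ?y = q a"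
    using SGmap_overlap[OF k(1,2) s(1,2)] SGmap_overlap[OF k(2,1) s(2,1)] e by auto
  have ac: "a \<noteq> c \<Longrightarrow> ?x = q c \<and> ?z = q a"
    using SGmap_overlap[OF k(1,3) s(1,3)] SGmap_overlap[OF k(3,1) s(3,1)] e by auto
  have bc: "b \<noteq> c \<Longrightarrow> ?y = q c \<and> ?z = q b"
    using SGmap_overlap[OF k(2,3) s(2,3)] SGmap_overlap[OF k(3,2) s(3,2)] e by auto
  have rep: "w' = u'" if "?x = q d" "?y = q d" "d \<in> {0,1,2}" for d
    using SGword_eq_vertex[OF s(4) _ that(3,1)] SGword_eq_vertex[OF s(5) _ that(3,2)] Suc.prems w u by auto
  have rep2: "w' = t'" if "?x = q d" "?z = q d" "d \<in> {0,1,2}" for d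
    using SGword_eq_vertex[OF s(4) _ that(3,1)] SGword_eq_vertex[OF s(6) _ that(3,2)] Suc.prems w t by auto
  have rep3: "u' = t'" if "?y = q d" "?z = q d" "d \<in> {0,1,2}" for d
    using SGword_eq_vertex[OF s(5) _ that(3,1)] SGword_eq_vertex[OF s(6) _ that(3,2)] Suc.prems u t by auto
  show ?case
  proof (cases "a = b")
    case True
    show ?thesis
    proof (cases "a = c")
      case c: True
      have "?x = ?y" "?x = ?z" using e True c by (auto simp: SGmap_def)
      then show ?thesis using Suc.IH[of w' u' t'] s Suc.prems w u t True c by auto
    next
      case False
      then show ?thesis using ac bc True rep[of c] s Suc.prems w u by auto
    qed
  next
    case False
    show ?thesis
    proof (cases "c = a")
      case True
      then show ?thesis using False ab bc rep2[of b] s w t by auto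
    next
      case ca: False
      show ?thesis
      proof (cases "c = b")
        case True
        then show ?thesis using False ab ac rep3[of a] s u t by auto
      next
        case False
        then have "q b = q c" using ab ac ca \<open>a \<noteq> b\<close> by auto
        then show ?thesis using q_inj s False by auto
      qed
    qed
  qed
qed simp

section \<open>Neighbours and the harmonic extension rule\<close>

text \<open>By \<open>SGword_three\<close> no third cell of the level contributes neighbours to a
  vertex shared by two cells.\<close>

lemma adj_set:
  assumes "w \<in> words n" "u \<in> words n" "w \<noteq> u" "i \<in> {0,1,2}" "j \<in> {0,1,2}"
    and eq: "SGword q w (q i) = SGword q u (q j)"
  shows "{y. adj q n (SGword q w (q i)) y} =
    (\<lambda>k. SGword q w (q k)) ` ({0,1,2} - {i}) \<union> (\<lambda>k. SGword q u (q k)) ` ({0,1,2} - {j})" (is "?L = ?R")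
proof (intro set_eqI iffI)
  fix y assume "y \<in> ?L"
  then obtain t where t: "t \<in> words n" "SGword q w (q i) \<in> SGword q t ` V0 q" "y \<in> SGword q t ` V0 q" "SGword q w (q i) \<noteq> y"
    by (auto simp: adj_def)
  obtain k l where k: "k \<in> {0,1,2}" "SGword q w (q i) = SGword q t (q k)"
     and l: "l \<in> {0,1,2}" "y = SGword q t (q l)" using t by (auto simp: V0_def)
  have "t = w \<or> t = u"
    by (rule SGword_three[OF _ _ _ _ _ _ assms(3) q_K[OF assms(4)] q_K[OF assms(5)] q_K[OF k(1)] eq k(2)])
      (use assms t in \<open>auto simp: words_def\<close>)
  then show "y \<in> ?R" using l t(4) eq by auto
next
  fix y assume "y \<in> ?R"
  then consider k where "k \<in> {0,1,2}" "k \<noteq> i" "y = SGword q w (q k)" |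
      k where "k \<in> {0,1,2}" "k \<noteq> j" "y = SGword q u (q k)" by blast
  then show "y \<in> ?L"
  proof cases
    case 1
    then have "SGword q w (q i) \<noteq> y" using assms(4) q_inj[of k i] by auto
    then show ?thesis using 1 assms(1,4) unfolding adj_def V0_def by blast
  next
    case 2
    then have "SGword q u (q j) \<noteq> y" using assms(5) q_inj[of k j] by auto
    then show ?thesis using 2 assms(2,5) unfolding adj_def V0_def eq by blast
  qed
qed

text \<open>The four neighbours are two in each cell. Adding the value at the shared vertex once per
  cell turns the factor 4 into 6 and completes both sums to full triangles.\<close>

lemma harmonic_two_cells:
  assumes h: "harmonic_SG q K h" and "w \<in> words n" "u \<in> words n" "w \<noteq> u" "i \<in> {0,1,2}" "j \<in> {0,1,2}"
    and eq: "SGword q w (q i) = SGword q u (q j)" and nV0: "SGword q w (q i) \<notin> V0 q"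
  shows "6 * h (SGword q w (q i)) = (\<Sum>k\<in>{0,1,2}. h (SGword q w (q k))) + (\<Sum>k\<in>{0,1,2}. h (SGword q u (q k)))"
proof -
  let ?x = "SGword q w (q i)"
  let ?A = "(\<lambda>k. SGword q w (q k)) ` ({0,1,2} - {i})" and ?B = "(\<lambda>k. SGword q u (q k)) ` ({0,1,2} - {j})"
  have "n \<noteq> 0"
  proof
    assume "n = 0"
    then show False using assms(2-4) by simp
  qed
  moreover have "?x \<in> Vm q n" using assms by (auto simp: Vm_def V0_def)
  ultimately have "h ?x = 1/4 * (\<Sum>y\<in>{y. adj q n ?x y}. h y)" using h nV0 by (auto simp: harmonic_SG_def)
  also have "{y. adj q n ?x y} = ?A \<union> ?B" using assms by (intro adj_set) auto
  also have "(\<Sum>y\<in>?A \<union> ?B. h y) = (\<Sum>y\<in>?A. h y) + (\<Sum>y\<in>?B. h y)"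
  proof (rule sum.union_disjoint)
    show "?A \<inter> ?B = {}"
    proof (rule ccontr)
      assume "?A \<inter> ?B \<noteq> {}"
      then obtain k l where kl: "k \<in> {0,1,2}" "k \<noteq> i" "l \<in> {0,1,2}" "SGword q w (q k) = SGword q u (q l)" by blast
      have "q i = q k"
        by (rule SGword_overlap_unique[OF _ _ _ assms(4) q_K[OF assms(5)] q_K[OF assms(6)] eq
            q_K[OF kl(1)] q_K[OF kl(3)] kl(4)]) (use assms in \<open>auto simp: words_def\<close>)
      then show False using q_inj assms kl by auto
    qed
  qed auto
  also have "(\<Sum>y\<in>?A. h y) = (\<Sum>k\<in>{0,1,2} - {i}. h (SGword q w (q k)))"
    by (subst sum.reindex) (auto simp: inj_on_def q_inj)
  also have "\<dots> = (\<Sum>k\<in>{0,1,2}. h (SGword q w (q k))) - h ?x"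
    by (subst sum_diff1) (use assms in auto)
  also have "(\<Sum>y\<in>?B. h y) = (\<Sum>k\<in>{0,1,2} - {j}. h (SGword q u (q k)))"
    by (subst sum.reindex) (auto simp: inj_on_def q_inj)
  also have "\<dots> = (\<Sum>k\<in>{0,1,2}. h (SGword q u (q k))) - h ?x"
    unfolding eq by (subst sum_diff1) (use assms in auto)
  finally show ?thesis by simp
qed

text \<open>The rule (2 h(a) + 2 h(b) + h(c)) / 5 for the midpoint of the edge ab, written so that
  the third vertex c need not be named. Constants satisfy it as well, so masses can be treated as
  integrals of the same kind.\<close>

definition edge_rule :: "(complex \<Rightarrow> real) \<Rightarrow> bool" where
  "edge_rule h \<longleftrightarrow> continuous_on K h \<and> (\<forall>u a b. set u \<subseteq> {0,1,2} \<longrightarrow> a \<in> {0,1,2} \<longrightarrow> b \<in> {0,1,2} \<longrightarrow> a \<noteq> b \<longrightarrow>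
    h (SGword q (u @ [a]) (q b)) =
      (h (SGword q u (q a)) + h (SGword q u (q b)) + (\<Sum>k\<in>{0,1,2}. h (SGword q u (q k)))) / 5)"

lemma edge_ruleD:
  assumes "edge_rule h" "set u \<subseteq> {0,1,2}" "a \<in> {0,1,2}" "b \<in> {0,1,2}" "a \<noteq> b"
  shows "h (SGword q (u @ [a]) (q b)) =
      (h (SGword q u (q a)) + h (SGword q u (q b)) + (\<Sum>k\<in>{0,1,2}. h (SGword q u (q k)))) / 5"
  by (rule assms(1)[unfolded edge_rule_def, THEN conjunct2, rule_format, OF assms(2-5)])

lemma harmonic_edge_rule:
  assumes h: "harmonic_SG q K h" shows "edge_rule h"
  unfolding edge_rule_def
proof (intro conjI allI impI)
  show "continuous_on K h" using h by (simp add: harmonic_SG_def)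
  fix u :: "nat list" and a b :: nat assume u: "set u \<subseteq> {0,1,2}" and ab: "a \<in> {0,1,2}" "b \<in> {0,1,2}" "a \<noteq> b"
  have sym: "SGword q (u @ [a]) (q b) = SGword q (u @ [b]) (q a)" for a b
    by (simp add: SGword_append SGmap_def add.commute)
  have diag: "SGword q (u @ [a]) (q a) = SGword q u (q a)" for a
    by (simp add: SGword_append SGmap_def)
  have mid: "6 * h (SGword q (u @ [a]) (q b)) =
      (\<Sum>k\<in>{0,1,2}. h (SGword q (u @ [a]) (q k))) + (\<Sum>k\<in>{0,1,2}. h (SGword q (u @ [b]) (q k)))"
    if ab: "a \<in> {0,1,2}" "b \<in> {0,1,2}" "a \<noteq> b" for a b
  proof (rule harmonic_two_cells[OF h _ _ _ ab(2,1) sym])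
    show "u @ [a] \<in> words (Suc (length u))" "u @ [b] \<in> words (Suc (length u))"
      using u ab by (auto simp: words_def)
    show "u @ [a] \<noteq> u @ [b]" using ab by simp
    \<comment> \<open>A midpoint equal to a vertex \<open>q c\<close> would have a constant address
      in the letter \<open>c\<close> and inner vertex \<open>q c\<close>, forcing
      \<open>a = c = b\<close>.\<close>
    show "SGword q (u @ [a]) (q b) \<notin> V0 q"
    proof
      assume "SGword q (u @ [a]) (q b) \<in> V0 q"
      then obtain c where c: "c \<in> {0,1,2}" "SGword q (u @ [a]) (q b) = q c" by (auto simp: V0_def)
      have *: "u @ [a] = replicate (length (u @ [a])) c \<and> q b = q c"
        by (rule SGword_eq_vertex[OF _ q_K[OF ab(2)] c]) (use u ab in auto)
      then have "a \<in> set (replicate (length (u @ [a])) c)" by (metis in_set_conv_decomp)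
      then show False using * q_inj ab c by auto
    qed
  qed
  have s: "SGword q (u @ [1]) (q 0) = SGword q (u @ [0]) (q 1)"
     "SGword q (u @ [2]) (q 0) = SGword q (u @ [0]) (q 2)" "SGword q (u @ [2]) (q 1) = SGword q (u @ [1]) (q 2)"
    by (rule sym)+
  \<comment> \<open>Three linear equations in the values at the three midpoints, with the corner
    values as data; solving them gives the rule.\<close>
  from mid[of 0 1] mid[of 0 2] mid[of 1 2] ab
  show "h (SGword q (u @ [a]) (q b)) =
      (h (SGword q u (q a)) + h (SGword q u (q b)) + (\<Sum>k\<in>{0,1,2}. h (SGword q u (q k)))) / 5"
    using s diag[of 0] diag[of 1] diag[of 2] by auto
qed

lemma edge_rule_one: "edge_rule (\<lambda>_. 1)"
  by (simp add: edge_rule_def)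

end

section \<open>The self-similar measure\<close>

lemma set_integral_finite_UN_AE:
  fixes f :: "_ \<Rightarrow> real"
  assumes "finite I" "\<And>i. i \<in> I \<Longrightarrow> A i \<in> sets M" "\<And>i. i \<in> I \<Longrightarrow> set_integrable M (A i) f"
    and "\<And>i j. i \<in> I \<Longrightarrow> j \<in> I \<Longrightarrow> i \<noteq> j \<Longrightarrow> AE x in M. \<not> (x \<in> A i \<and> x \<in> A j)"
  shows "(LINT x:(\<Union>i\<in>I. A i)|M. f x) = (\<Sum>i\<in>I. LINT x:A i|M. f x)"
  using assms
proof (induction I rule: finite_induct)
  case (insert i I)
  have "AE x in M. \<forall>j\<in>I. \<not> (x \<in> A i \<and> x \<in> A j)"
    using insert by (intro AE_finite_allI) auto
  then have ae: "AE x in M. \<not> (x \<in> A i \<and> x \<in> (\<Union>j\<in>I. A j))" by eventually_elim blast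
  have "(LINT x:(A i \<union> (\<Union>j\<in>I. A j))|M. f x) = (LINT x:A i|M. f x) + (LINT x:(\<Union>j\<in>I. A j)|M. f x)"
    using insert by (intro set_integral_Un_AE ae set_integrable_UN) auto
  then show ?case using insert by simp
qed (simp add: set_lebesgue_integral_def)

context gasket
begin

lemma cell_append: "cell q K (u @ v) = SGword q u ` cell q K v"
  by (simp add: cell_def image_image SGword_append)

lemma K_words: "K = (\<Union>v\<in>words n. cell q K v)"
proof (induction n)
  case (Suc n)
  have "(\<Union>v\<in>words (Suc n). cell q K v) = (\<Union>i\<in>{0,1,2}. SGmap q i ` (\<Union>v\<in>words n. cell q K v))"
    by (simp add: words_Suc cell_def image_Un image_UN image_comp)
  also have "\<dots> = K" using K_eq Suc by simp
  finally show ?case by simp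
qed (simp add: cell_def)

lemma cell_words: "cell q K u = (\<Union>v\<in>words n. cell q K (u @ v))"
proof -
  have "cell q K u = SGword q u ` (\<Union>v\<in>words n. cell q K v)" using K_words[of n] by (simp add: cell_def)
  then show ?thesis by (simp add: cell_append image_UN)
qed

lemma cell_subset_K: "set u \<subseteq> {0,1,2} \<Longrightarrow> cell q K u \<subseteq> K"
  unfolding cell_def using SGword_K by blast

lemma closed_cell: "closed (cell q K u)"
  unfolding cell_def by (intro compact_imp_closed compact_continuous_image continuous_SGword K_compact)

lemma set_append_words: "v \<in> words n \<Longrightarrow> set u \<subseteq> {0,1,2} \<Longrightarrow> set (u @ v) \<subseteq> {0,1,2}"
  by (simp add: words_def)

lemma inner_SGword_bounds:
  fixes e :: complex
  assumes "z \<in> K"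
  shows "(\<And>i. i \<in> {0,1,2} \<Longrightarrow> inner (SGword q u (q i)) e \<le> M) \<Longrightarrow> inner (SGword q u z) e \<le> M"
    and "(\<And>i. i \<in> {0,1,2} \<Longrightarrow> m \<le> inner (SGword q u (q i)) e) \<Longrightarrow> m \<le> inner (SGword q u z) e"
proof -
  have mid: "inner (SGword q u (SGmap q i z)) e = (inner (SGword q u z) e + inner (SGword q u (q i)) e) / 2"
    for z i
  proof -
    have "SGword q u (SGmap q i z) = (1/2) *\<^sub>R (SGword q u z + SGword q u (q i))"
      by (simp add: SGmap_def SGword_mid scaleR_conv_of_real)
    then show ?thesis by (simp add: inner_add_left)
  qed
  have c: "continuous_on K (\<lambda>z. inner (SGword q u z) e)" by (intro continuous_intros continuous_SGword)
  show "inner (SGword q u z) e \<le> M" if "\<And>i. i \<in> {0,1,2} \<Longrightarrow> inner (SGword q u (q i)) e \<le> M"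
    by (rule bound_on_K[OF c _ that assms]) (simp_all only: mid order_refl)
  have c': "continuous_on K (\<lambda>z. - inner (SGword q u z) e)" by (intro continuous_intros c)
  have "- inner (SGword q u z) e \<le> - m" if "\<And>i. i \<in> {0,1,2} \<Longrightarrow> m \<le> inner (SGword q u (q i)) e"
    by (rule bound_on_K[OF c' _ _ assms]) (unfold mid add_divide_distrib, linarith, use that in simp)
  then show "m \<le> inner (SGword q u z) e" if "\<And>i. i \<in> {0,1,2} \<Longrightarrow> m \<le> inner (SGword q u (q i)) e"
    using that by fastforce
qed

text \<open>The repeated letter contracts by 1/4 towards a vertex. Two levels, unlike one, separate
  the corner where a linear functional is largest from the corner where it is smallest.\<close>

lemma inner_SGword_corner:
  fixes e :: complex
  shows "inner (SGword q (u @ [i,i]) z) e = inner (SGword q u z) e / 4 + 3/4 * inner (SGword q u (q i)) e"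
proof -
  have "SGword q (u @ [i,i]) z = (1/4) *\<^sub>R SGword q u z + (3/4) *\<^sub>R SGword q u (q i)"
  proof -
    have "SGword q (u @ [i,i]) z = SGword q u (((z + q i) / 2 + q i) / 2)"
      by (simp add: SGword_append SGmap_def)
    also have "\<dots> = ((SGword q u z + SGword q u (q i)) / 2 + SGword q u (q i)) / 2"
      by (simp only: SGword_mid)
    also have "\<dots> = (1/4) *\<^sub>R SGword q u z + (3/4) *\<^sub>R SGword q u (q i)"
      by (simp add: scaleR_conv_of_real field_simps)
    finally show ?thesis .
  qed
  then show ?thesis by (simp add: inner_add_left)
qed

end

locale gasket_measure = gasket +
  fixes \<mu> :: "complex measure"
  assumes meas: "is_SG_measure q K \<mu>"
begin

sublocale prob_space \<mu>
  using meas by (simp add: is_SG_measure_def)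

lemma sets_\<mu> [simp, measurable_cong]: "sets \<mu> = sets borel"
  using meas by (simp add: is_SG_measure_def)

lemma space_\<mu> [simp]: "space \<mu> = UNIV"
  using sets_eq_imp_space_eq[OF sets_\<mu>] by simp

lemma measure_cell: "set u \<subseteq> {0,1,2} \<Longrightarrow> measure \<mu> (cell q K u) = 1 / 3 ^ length u"
  using meas by (simp add: is_SG_measure_def)

lemma sets_cell [measurable]: "cell q K u \<in> sets \<mu>"
  unfolding sets_\<mu> by (rule borel_closed[OF closed_cell])

section \<open>Lines and points have measure zero\<close>

text \<open>Of the nine subcells two levels down a line misses at least one, so each iteration gains
  a factor 8/9. One level would not do: the two extreme subcells share the middle value of the
  functional. The assumption on \<open>e\<close> says that the functional is not constant on the
  vertices.\<close>

lemma measure_cell_line_le: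
  assumes "a \<in> {0,1,2}" "b \<in> {0,1,2}" "inner (q a) e \<noteq> inner (q b) e" "set u \<subseteq> {0,1,2}"
  shows "measure \<mu> (cell q K u \<inter> {z. inner z e = t}) \<le> (8/9) ^ k / 3 ^ length u"
  using assms(4)
proof (induction k arbitrary: u)
  case 0
  have "measure \<mu> (cell q K u \<inter> {z. inner z e = t}) \<le> measure \<mu> (cell q K u)"
    by (rule finite_measure_mono[OF Int_lower1 sets_cell])
  then show ?case using measure_cell[OF 0] by simp
next
  case (Suc k)
  let ?L = "{z. inner z e = t}"
  define g where "g i = inner (SGword q u (q i)) e" for i
  have "g a - g b = inner (SGword q u (q a) - SGword q u (q b)) e"
    by (simp add: g_def inner_diff_left)
  also have "SGword q u (q a) - SGword q u (q b) = (1 / 2 ^ length u) *\<^sub>R (q a - q b)"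
    by (simp add: SGword_diff scaleR_conv_of_real)
  finally have gab: "g a \<noteq> g b" using assms(3) by (auto simp: inner_diff_left)
  obtain i where i: "i \<in> {0,1,2}" "\<And>l. l \<in> {0,1,2} \<Longrightarrow> g l \<le> g i"
    using ex_is_arg_min_if_finite[of "{0,1,2}" "\<lambda>l. - g l"] unfolding is_arg_min_linorder by auto
  obtain j where j: "j \<in> {0,1,2}" "\<And>l. l \<in> {0,1,2} \<Longrightarrow> g j \<le> g l"
    using ex_is_arg_min_if_finite[of "{0,1,2}" g] unfolding is_arg_min_linorder by blast
  have ij: "g j < g i" using i(2)[OF assms(1)] i(2)[OF assms(2)] j(2)[OF assms(1)] j(2)[OF assms(2)] gab by linarith
  have bd: "g j \<le> inner (SGword q u z) e \<and> inner (SGword q u z) e \<le> g i" if "z \<in> K" for z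
    using inner_SGword_bounds[OF that, where u = u and e = e] i(2) j(2) unfolding g_def by blast
  \<comment> \<open>On the top corner cell the functional is at least
    \<open>g j / 4 + 3/4 * g i\<close>, on the bottom one at most
    \<open>g i / 4 + 3/4 * g j\<close>. As \<open>g j < g i\<close>, no value \<open>t\<close>
    occurs on both.\<close>
  have "\<exists>v\<in>words 2. cell q K (u @ v) \<inter> ?L = {}"
  proof (rule ccontr)
    assume "\<not> ?thesis"
    moreover have "[i,i] \<in> words 2" "[j,j] \<in> words 2" using i j by (auto simp: words_def)
    ultimately have ne: "cell q K (u @ [i,i]) \<inter> ?L \<noteq> {}" "cell q K (u @ [j,j]) \<inter> ?L \<noteq> {}" by blast+
    obtain y where y: "y \<in> K" "inner (SGword q (u @ [i,i]) y) e = t"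
      using ne(1) unfolding cell_def by blast
    obtain z where z: "z \<in> K" "inner (SGword q (u @ [j,j]) z) e = t"
      using ne(2) unfolding cell_def by blast
    have "g j / 4 + 3/4 * g i \<le> t"
      using bd[OF y(1)] y(2) unfolding inner_SGword_corner g_def by linarith
    moreover have "t \<le> g i / 4 + 3/4 * g j"
      using bd[OF z(1)] z(2) unfolding inner_SGword_corner g_def by linarith
    ultimately show False using ij by linarith
  qed
  then obtain v where v: "v \<in> words 2" "cell q K (u @ v) \<inter> ?L = {}" by blast
  have eq: "cell q K u \<inter> ?L = (\<Union>v'\<in>words 2 - {v}. cell q K (u @ v') \<inter> ?L)"
    using cell_words[of u 2] v(2) by blast
  have "closed ?L" by (intro closed_Collect_eq continuous_intros)
  then have "cell q K v \<inter> ?L \<in> sets \<mu>" for v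
    unfolding sets_\<mu> by (intro borel_closed closed_Int closed_cell)
  then have "measure \<mu> (cell q K u \<inter> ?L) \<le> (\<Sum>v'\<in>words 2 - {v}. measure \<mu> (cell q K (u @ v') \<inter> ?L))"
    unfolding eq by (intro finite_measure_subadditive_finite) (simp_all add: image_subset_iff)
  also have "\<dots> \<le> (\<Sum>v'\<in>words 2 - {v}. (8/9) ^ k / 3 ^ (length u + 2))"
  proof (intro sum_mono)
    fix v' assume "v' \<in> words 2 - {v}"
    then have v': "v' \<in> words 2" by simp
    then have "length v' = 2" by (simp add: words_def)
    then show "measure \<mu> (cell q K (u @ v') \<inter> ?L) \<le> (8/9) ^ k / 3 ^ (length u + 2)"
      using Suc.IH[OF set_append_words[OF v' Suc.prems]] by simp
  qed
  also have "\<dots> = 8 * ((8/9) ^ k / 3 ^ (length u + 2))"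
    using v card_words[of 2] by (simp add: card_Diff_singleton)
  also have "\<dots> = (8/9) ^ Suc k / 3 ^ length u" by (simp add: power_add)
  finally show ?case .
qed

lemma measure_cell_line:
  assumes "a \<in> {0,1,2}" "b \<in> {0,1,2}" "inner (q a) e \<noteq> inner (q b) e" "set u \<subseteq> {0,1,2}"
  shows "measure \<mu> (cell q K u \<inter> {z. inner z e = t}) = 0"
proof -
  have "(\<lambda>k. (8/9) ^ k / 3 ^ length u :: real) \<longlonglongrightarrow> 0"
    by (intro tendsto_divide_zero LIMSEQ_power_zero) simp
  then have "measure \<mu> (cell q K u \<inter> {z. inner z e = t}) \<le> 0"
    by (rule LIMSEQ_le_const[of _ 0]) (use measure_cell_line_le[OF assms] in blast)
  then show ?thesis by (simp add: antisym)
qed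

lemma null_singleton: assumes "x \<in> K" shows "{x} \<in> null_sets \<mu>"
proof -
  let ?e = "q 1 - q 0"
  have "inner (q 1) ?e - inner (q 0) ?e = inner ?e ?e" by (simp add: inner_diff_left)
  then have "inner (q 1) ?e \<noteq> inner (q 0) ?e" using q01 by auto
  then have "measure \<mu> (cell q K [] \<inter> {z. inner z ?e = inner x ?e}) = 0"
    by (intro measure_cell_line[of 1 0]) auto
  moreover have "measure \<mu> {x} \<le> measure \<mu> (cell q K [] \<inter> {z. inner z ?e = inner x ?e})"
  proof (rule finite_measure_mono)
    have "closed {z. inner z ?e = inner x ?e}" by (intro closed_Collect_eq continuous_intros)
    then show "cell q K [] \<inter> {z. inner z ?e = inner x ?e} \<in> sets \<mu>"
      unfolding sets_\<mu> by (intro borel_closed closed_Int closed_cell)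
  qed (use assms in \<open>simp add: cell_def\<close>)
  ultimately have "measure \<mu> {x} = 0" by (simp add: measure_le_0_iff)
  then show ?thesis by (auto simp: null_sets_def emeasure_eq_measure)
qed

lemma AE_cells_disjoint:
  assumes "set u \<subseteq> {0,1,2}" "set v \<subseteq> {0,1,2}" "length u = length v" "u \<noteq> v"
  shows "AE x in \<mu>. \<not> (x \<in> cell q K u \<and> x \<in> cell q K v)"
proof (cases "cell q K u \<inter> cell q K v = {}")
  case False
  then obtain x where x: "x \<in> cell q K u" "x \<in> cell q K v" by blast
  have "y = x" if y: "y \<in> cell q K u" "y \<in> cell q K v" for y
  proof -
    obtain a c where ac: "a \<in> K" "c \<in> K" "SGword q u a = x" "SGword q u c = y"
      using x(1) y(1) unfolding cell_def by blast
    obtain b d where bd: "b \<in> K" "d \<in> K" "SGword q v b = x" "SGword q v d = y"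
      using x(2) y(2) unfolding cell_def by blast
    have "a = c"
      by (rule SGword_overlap_unique[OF assms ac(1) bd(1) _ ac(2) bd(2)]) (simp_all only: ac bd)
    then show ?thesis using ac by simp
  qed
  then have sub: "{z \<in> space \<mu>. \<not> \<not> (z \<in> cell q K u \<and> z \<in> cell q K v)} \<subseteq> {x}" by blast
  have "x \<in> K" using x(1) cell_subset_K[OF assms(1)] by blast
  then show ?thesis by (rule AE_I'[OF null_singleton sub])
next
  case True
  then have "\<not> (x \<in> cell q K u \<and> x \<in> cell q K v)" for x by blast
  then show ?thesis by simp
qed

lemma set_integrable_K:
  assumes "continuous_on K (h :: complex \<Rightarrow> real)" "A \<subseteq> K" "A \<in> sets \<mu>"
  shows "set_integrable \<mu> A h"
proof -
  have "bounded (h ` K)" by (rule compact_imp_bounded[OF compact_continuous_image[OF assms(1) K_compact]])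
  then obtain C where C: "\<And>x. x \<in> K \<Longrightarrow> norm (h x) \<le> C" by (auto simp: bounded_iff)
  have "K \<in> sets borel" by (rule borel_closed[OF compact_imp_closed[OF K_compact]])
  then have "set_integrable \<mu> K h"
    unfolding set_integrable_def
  proof (intro integrable_const_bound[where B = "max C 0"])
    show "AE x in \<mu>. norm (indicator K x *\<^sub>R h x) \<le> max C 0"
      by (intro AE_I2) (simp add: indicator_def le_max_iff_disj C[simplified])
    show "(\<lambda>x. indicator K x *\<^sub>R h x) \<in> borel_measurable \<mu>"
      using borel_measurable_continuous_on_indicator[OF \<open>K \<in> sets borel\<close> assms(1)]
      by (simp add: measurable_cong_sets[OF sets_\<mu> refl])
  qed
  then show ?thesis by (rule set_integrable_subset[OF _ assms(3,2)])
qed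

lemma set_integrable_cell:
  "continuous_on K (h :: complex \<Rightarrow> real) \<Longrightarrow> set u \<subseteq> {0,1,2} \<Longrightarrow> set_integrable \<mu> (cell q K u) h"
  by (intro set_integrable_K cell_subset_K sets_cell)

lemma integral_subcells:
  fixes h :: "complex \<Rightarrow> real"
  assumes "continuous_on K h" "set u \<subseteq> {0,1,2}" "D \<subseteq> words n"
  shows "(LINT x:(\<Union>v\<in>D. cell q K (u @ v))|\<mu>. h x) = (\<Sum>v\<in>D. LINT x:cell q K (u @ v)|\<mu>. h x)"
proof (rule set_integral_finite_UN_AE)
  show "finite D" using finite_subset[OF assms(3)] by simp
  fix v assume v: "v \<in> D"
  then have sv: "set (u @ v) \<subseteq> {0,1,2}" using assms set_append_words by blast
  then show "set_integrable \<mu> (cell q K (u @ v)) h" using assms(1) by (intro set_integrable_cell)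
  fix v' assume v': "v' \<in> D" "v \<noteq> v'"
  then have "set (u @ v') \<subseteq> {0,1,2}" using assms set_append_words by blast
  moreover have "length v = length v'" using v v' assms(3) by (auto simp: words_def)
  ultimately show "AE x in \<mu>. \<not> (x \<in> cell q K (u @ v) \<and> x \<in> cell q K (u @ v'))"
    using sv v' by (intro AE_cells_disjoint) auto
qed (rule sets_cell)

section \<open>Integrals of harmonic functions over cells\<close>

definition vertex_avg :: "(complex \<Rightarrow> real) \<Rightarrow> nat list \<Rightarrow> real" where
  "vertex_avg h u = (\<Sum>k\<in>{0,1,2}. h (SGword q u (q k))) / 3"

text \<open>Each corner value occurs once and each midpoint value twice among the nine vertices of
  the subcells. This makes \<open>vertex_avg\<close> times cell mass additive under
  subdivision.\<close>

lemma edge_rule_avg: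
  assumes "edge_rule h" "set u \<subseteq> {0,1,2}"
  shows "(\<Sum>a\<in>{0,1,2}. vertex_avg h (u @ [a])) = 3 * vertex_avg h u"
proof -
  have diag: "SGword q (u @ [a]) (q a) = SGword q u (q a)" for a
    by (simp add: SGword_append SGmap_def)
  define y where "y k = h (SGword q u (q k))" for k
  have e: "h (SGword q (u @ [a]) (q b)) = (y a + y b + (y 0 + y 1 + y 2)) / 5"
    if "a \<in> {0,1,2}" "b \<in> {0,1,2}" "a \<noteq> b" for a b
    using edge_ruleD[OF assms that] by (simp add: y_def add.assoc)
  have d: "h (SGword q (u @ [a]) (q a)) = y a" for a by (simp add: diag y_def)
  show ?thesis
    unfolding vertex_avg_def y_def[symmetric]
    using e[of 0 1] e[of 0 2] e[of 1 0] e[of 1 2] e[of 2 0] e[of 2 1] d[of 0] d[of 1] d[of 2]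
    by (simp add: add_divide_distrib)
qed

text \<open>The integral and the candidate value are both additive under subdivision, hence so is
  their difference \<open>d\<close>. On tiny cells uniform continuity makes \<open>d\<close> small
  relative to the cell mass, and adding up keeps this bound.\<close>

lemma integral_cell:
  assumes h: "edge_rule h" and u: "set u \<subseteq> {0,1,2}"
  shows "(LINT x:cell q K u|\<mu>. h x) = vertex_avg h u / 3 ^ length u"
proof -
  define d where "d u = (LINT x:cell q K u|\<mu>. h x) - vertex_avg h u / 3 ^ length u" for u
  have cont: "continuous_on K h" using h by (simp add: edge_rule_def)
  have split: "d u = (\<Sum>a\<in>{0,1,2}. d (u @ [a]))" if "set u \<subseteq> {0,1,2}" for u
  proof -
    have "(LINT x:cell q K u|\<mu>. h x) = (\<Sum>v\<in>words (Suc 0). LINT x:cell q K (u @ v)|\<mu>. h x)"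
      using integral_subcells[OF cont that order_refl, of "Suc 0"] cell_words[of u "Suc 0"] by simp
    also have "\<dots> = (\<Sum>a\<in>{0,1,2}. LINT x:cell q K (u @ [a])|\<mu>. h x)"
      by (simp only: sum_words_Suc) simp
    finally have 1: "(LINT x:cell q K u|\<mu>. h x) = (\<Sum>a\<in>{0,1,2}. LINT x:cell q K (u @ [a])|\<mu>. h x)" .
    have "(\<Sum>a\<in>{0,1,2}. vertex_avg h (u @ [a]) / 3 ^ length (u @ [a])) = vertex_avg h u / 3 ^ length u"
      using edge_rule_avg[OF h that] by (simp add: add_divide_distrib[symmetric])
    then show ?thesis unfolding d_def sum_subtractf 1 by simp
  qed
  have small: "\<bar>d u\<bar> \<le> \<epsilon>" if \<epsilon>: "\<epsilon> > 0" for \<epsilon>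
  proof -
    have "uniformly_continuous_on K h" by (rule compact_uniformly_continuous[OF cont K_compact])
    from this[unfolded uniformly_continuous_on_def, rule_format, OF \<epsilon>]
    obtain \<delta> where \<delta>: "\<delta> > 0" "\<And>x y. x \<in> K \<Longrightarrow> y \<in> K \<Longrightarrow> dist x y < \<delta> \<Longrightarrow> dist (h x) (h y) < \<epsilon>"
      by blast
    define C where "C = diameter K"
    have C: "dist x y \<le> C" if "x \<in> K" "y \<in> K" for x y
      unfolding C_def by (rule diameter_bounded_bound[OF compact_imp_bounded[OF K_compact] that])
    have "(\<lambda>n. C / 2 ^ n) \<longlonglongrightarrow> 0" by (rule LIMSEQ_divide_realpow_zero) simp
    then have "\<forall>\<^sub>F n in sequentially. C / 2 ^ n < \<delta> \<and> n \<ge> length u"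
      using \<delta>(1) by (intro eventually_conj eventually_ge_at_top order_tendstoD(2)) auto
    then obtain N where N: "C / 2 ^ N < \<delta>" "length u \<le> N" unfolding eventually_sequentially by blast
    \<comment> \<open>The induction climbs from the fine level \<open>N\<close>; \<open>k\<close>
      counts the levels still separating \<open>u\<close> from it.\<close>
    have "\<bar>d u\<bar> \<le> \<epsilon> / 3 ^ length u" if "set u \<subseteq> {0,1,2}" "length u + k = N" for k u
      using that
    proof (induction k arbitrary: u)
      case 0
      have close: "\<bar>h (SGword q u x) - h (SGword q u y)\<bar> \<le> \<epsilon>" if "x \<in> K" "y \<in> K" for x y
      proof -
        have "dist (SGword q u x) (SGword q u y) = dist x y / 2 ^ N"
          using 0 by (simp add: dist_norm SGword_diff norm_divide norm_power)
        also have "\<dots> \<le> C / 2 ^ N" using C[OF that] by (simp add: divide_right_mono)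
        finally have "dist (SGword q u x) (SGword q u y) < \<delta>" using N by linarith
        then show ?thesis
          using \<delta>(2)[OF SGword_K[OF 0(1) that(1)] SGword_K[OF 0(1) that(2)]] by (simp add: dist_real_def)
      qed
      have bd: "vertex_avg h u - \<epsilon> \<le> h z \<and> h z \<le> vertex_avg h u + \<epsilon>" if z: "z \<in> cell q K u" for z
      proof -
        obtain x where x: "x \<in> K" "z = SGword q u x" using z unfolding cell_def by blast
        have "\<bar>h z - h (SGword q u (q k))\<bar> \<le> \<epsilon>" if "k \<in> {0,1,2}" for k
          unfolding x(2) by (intro close x q_K that)
        from this[of 0] this[of 1] this[of 2]
        have "\<bar>h z - h (SGword q u (q 0))\<bar> \<le> \<epsilon>" "\<bar>h z - h (SGword q u (q 1))\<bar> \<le> \<epsilon>"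
          "\<bar>h z - h (SGword q u (q 2))\<bar> \<le> \<epsilon>" by simp_all
        moreover have "vertex_avg h u = h (SGword q u (q 0)) / 3 + h (SGword q u (q 1)) / 3 + h (SGword q u (q 2)) / 3"
          by (simp add: vertex_avg_def add_divide_distrib)
        ultimately show ?thesis by linarith
      qed
      have int: "set_integrable \<mu> (cell q K u) h" "set_integrable \<mu> (cell q K u) (\<lambda>_. c)" for c :: real
        by (rule set_integrable_cell[OF cont 0(1)] set_integrable_cell[OF continuous_on_const 0(1)])+
      have const: "(LINT x:cell q K u|\<mu>. c) = c / 3 ^ length u" for c :: real
      proof -
        have "(LINT x:cell q K u|\<mu>. c) = measure \<mu> (cell q K u) *\<^sub>R c"
          by (rule set_integral_const[OF sets_cell]) (simp add: emeasure_eq_measure)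
        then show ?thesis using measure_cell[OF 0(1)] by simp
      qed
      have "(vertex_avg h u - \<epsilon>) / 3 ^ length u \<le> (LINT x:cell q K u|\<mu>. h x)"
        unfolding const[symmetric] using bd by (intro set_integral_mono int) auto
      moreover have "(LINT x:cell q K u|\<mu>. h x) \<le> (vertex_avg h u + \<epsilon>) / 3 ^ length u"
        unfolding const[symmetric] using bd by (intro set_integral_mono int) auto
      ultimately show ?case unfolding d_def abs_le_iff add_divide_distrib diff_divide_distrib by simp
    next
      case (Suc k)
      have "\<bar>d u\<bar> \<le> (\<Sum>a\<in>{0,1,2}. \<bar>d (u @ [a])\<bar>)" unfolding split[OF Suc.prems(1)] by (rule sum_abs)
      also have "\<dots> \<le> (\<Sum>a\<in>{0,1,2::nat}. \<epsilon> / 3 ^ Suc (length u))"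
      proof (rule sum_mono)
        fix a :: nat assume a: "a \<in> {0,1,2}"
        then have "\<bar>d (u @ [a])\<bar> \<le> \<epsilon> / 3 ^ length (u @ [a])"
          using Suc.prems by (intro Suc.IH) (simp_all del: insert_iff)
        then show "\<bar>d (u @ [a])\<bar> \<le> \<epsilon> / 3 ^ Suc (length u)" by simp
      qed
      also have "\<dots> = \<epsilon> / 3 ^ length u" by simp
      finally show ?case .
    qed
    from this[OF u, of "N - length u"] N have "\<bar>d u\<bar> \<le> \<epsilon> / 3 ^ length u" by simp
    also have "\<dots> \<le> \<epsilon>" using \<epsilon> by (simp add: divide_le_eq)
    finally show ?thesis .
  qed
  have "\<bar>d u\<bar> \<le> 0"
    by (rule field_le_epsilon) (simp only: add_0_left small)
  then show ?thesis by (simp add: d_def)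
qed

end

section \<open>Cutting a cell parallel to a side\<close>

text \<open>One step of the 2/5-2/5-1/5 rule: from values \<open>x\<close> at the vertices of a
  triangle to the values at the vertices of its subtriangle \<open>i\<close>. Iterating it along an
  address gives \<open>cell_avg\<close>, which involves no function on the gasket; only the
  arguments 0, 1, 2 matter.\<close>

definition extend :: "nat \<Rightarrow> (nat \<Rightarrow> real) \<Rightarrow> nat \<Rightarrow> real" where
  "extend i x j = (if j = i then x i else (x i + x j + (x 0 + x 1 + x 2)) / 5)"

fun cell_avg :: "nat list \<Rightarrow> (nat \<Rightarrow> real) \<Rightarrow> real" where
  "cell_avg [] x = (x 0 + x 1 + x 2) / 3"
| "cell_avg (i # v) x = cell_avg v (extend i x)"

lemma cell_avg_cong:
  assumes "set v \<subseteq> {0,1,2}" "\<And>l. l \<in> {0,1,2} \<Longrightarrow> x l = y l"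
  shows "cell_avg v x = cell_avg v y"
  using assms
proof (induction v arbitrary: x y)
  case (Cons i v)
  have i: "i \<in> {0,1,2}" "set v \<subseteq> {0,1,2}" using Cons.prems(1) by auto
  have "extend i x l = extend i y l" if "l \<in> {0,1,2}" for l
    using Cons.prems(2)[OF that] Cons.prems(2)[OF i(1)] Cons.prems(2)[of 0] Cons.prems(2)[of 1] Cons.prems(2)[of 2]
    by (simp add: extend_def)
  then show ?case using Cons.IH[OF i(2), of "extend i x" "extend i y"] by simp
qed simp

lemma cell_avg_linear: "cell_avg v (\<lambda>l. c * x l + d * y l) = c * cell_avg v x + d * cell_avg v y"
proof (induction v arbitrary: x y)
  case (Cons i v)
  have "extend i (\<lambda>l. c * x l + d * y l) = (\<lambda>l. c * extend i x l + d * extend i y l)"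
    by (rule ext) (simp add: extend_def algebra_simps add_divide_distrib)
  then show ?case by (simp add: Cons.IH)
qed (simp add: algebra_simps add_divide_distrib)

lemma cell_avg_const: "cell_avg v (\<lambda>l. c) = c"
proof (induction v)
  case (Cons i v)
  have "extend i (\<lambda>l. c) = (\<lambda>l. c)" by (rule ext) (simp add: extend_def)
  then show ?case using Cons by simp
qed simp

lemma cell_avg_nonneg: "(\<And>l. 0 \<le> x l) \<Longrightarrow> 0 \<le> cell_avg v x"
proof (induction v arbitrary: x)
  case (Cons i v)
  have "0 \<le> extend i x l" for l using Cons.prems by (simp add: extend_def)
  then have "0 \<le> cell_avg v (extend i x)" by (rule Cons.IH)
  then show ?case by simp
qed simp

lemma cell_avg_le_1:
  assumes "\<And>l. x l \<le> 1" shows "cell_avg v x \<le> 1"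
proof -
  have "0 \<le> cell_avg v (\<lambda>l. 1 * 1 + (-1) * x l)" by (rule cell_avg_nonneg) (use assms in simp)
  then show ?thesis unfolding cell_avg_linear cell_avg_const by simp
qed

lemma extend_sum: "(\<Sum>a\<in>{0,1,2}. cell_avg [] (extend a x)) = 3 * cell_avg [] x"
  by (simp add: extend_def add_divide_distrib)

text \<open>The recursion consumes addresses from the front while refinement adds letters at the
  end; induction carries the one-step identity \<open>extend_sum\<close> to the innermost
  triangle.\<close>

lemma cell_avg_snoc: "(\<Sum>a\<in>{0,1,2}. cell_avg (v @ [a]) x) = 3 * cell_avg v x"
proof (induction v arbitrary: x)
  case Nil
  show ?case using extend_sum[of x] by simp
qed simp

lemma cell_avg_words: "(\<Sum>v\<in>words n. cell_avg v x) = 3 ^ n * cell_avg [] x"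
proof (induction n arbitrary: x)
  case (Suc n)
  have "(\<Sum>v\<in>words (Suc n). cell_avg v x) = (\<Sum>i\<in>{0,1,2}. \<Sum>v\<in>words n. cell_avg v (extend i x))"
    by (simp only: sum_words_Suc cell_avg.simps)
  also have "\<dots> = 3 ^ n * (\<Sum>i\<in>{0,1,2}. cell_avg [] (extend i x))"
    by (simp only: Suc sum_distrib_left)
  finally show ?case by (simp only: extend_sum) simp
qed simp

text \<open>The extension rule treats all indices alike, so renaming the letters of the address
  amounts to renaming the boundary values.\<close>

lemma cell_avg_transpose:
  assumes "r \<in> {0,1,2}" "s \<in> {0,1,2}"
  shows "cell_avg (map (Transposition.transpose r s) v) x = cell_avg v (\<lambda>l. x (Transposition.transpose r s l))"
proof (induction v arbitrary: x)
  case Nil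
  show ?case using assms by (auto simp: Transposition.transpose_def)
next
  case (Cons i v)
  have S: "x (Transposition.transpose r s 0) + x (Transposition.transpose r s 1) + x (Transposition.transpose r s 2) = x 0 + x 1 + x 2"
    using assms by (auto simp: Transposition.transpose_def)
  have "(\<lambda>l. extend (Transposition.transpose r s i) x (Transposition.transpose r s l)) = extend i (\<lambda>l. x (Transposition.transpose r s l))"
    unfolding extend_def S by (simp add: inj_eq[OF inj_transpose])
  then show ?case by (simp add: Cons.IH)
qed

context gasket_measure
begin

text \<open>This makes integrals over subcells of \<open>u\<close> linear in the three vertex values
  of \<open>u\<close>, with coefficients independent of \<open>h\<close>.\<close>

lemma vertex_avg_append:
  assumes "edge_rule h" "set u \<subseteq> {0,1,2}" "set v \<subseteq> {0,1,2}"
  shows "vertex_avg h (u @ v) = cell_avg v (\<lambda>l. h (SGword q u (q l)))"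
  using assms(2,3)
proof (induction v arbitrary: u)
  case Nil
  show ?case by (simp add: vertex_avg_def add.assoc)
next
  case (Cons i v)
  have i: "i \<in> {0,1,2}" "set v \<subseteq> {0,1,2}" "set (u @ [i]) \<subseteq> {0,1,2}" using Cons.prems by auto
  have "cell_avg v (\<lambda>l. h (SGword q (u @ [i]) (q l))) = cell_avg v (extend i (\<lambda>l. h (SGword q u (q l))))"
  proof (rule cell_avg_cong[OF i(2)])
    fix l :: nat assume l: "l \<in> {0,1,2}"
    show "h (SGword q (u @ [i]) (q l)) = extend i (\<lambda>l. h (SGword q u (q l))) l"
    proof (cases "l = i")
      case True
      then show ?thesis by (simp add: extend_def SGword_append SGmap_def)
    next
      case False
      then have "h (SGword q (u @ [i]) (q l)) = (h (SGword q u (q i)) + h (SGword q u (q l)) +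
          (\<Sum>k\<in>{0,1,2}. h (SGword q u (q k)))) / 5"
        by (intro edge_ruleD[OF assms(1) Cons.prems(1) i(1) l]) simp
      then show ?thesis using False by (simp add: extend_def add.assoc)
    qed
  qed
  then show ?case using Cons.IH[OF i(3,2)] by simp
qed

end

section \<open>Exhausting a cut by cells below the line\<close>

text \<open>Here \<open>k\<close> is the index of the cut vertex inside the cell \<open>u\<close>.
  That \<open>e\<close> points along the symmetry axis is encoded by the heights: 0 at this vertex
  and \<rho> at both others.\<close>

locale gasket_cut = gasket_measure +
  fixes u :: "nat list" and k :: nat and e :: complex and \<rho> :: real
  assumes u: "set u \<subseteq> {0,1,2}" and k: "k \<in> {0,1,2}" and \<rho>: "\<rho> > 0"
    and height: "\<And>l. l \<in> {0,1,2} \<Longrightarrow> inner (SGword q u (q l) - SGword q u (q k)) e = (if l = k then 0 else \<rho>)"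
begin

definition ht :: "complex \<Rightarrow> real" where "ht z = inner (z - SGword q u (q k)) e"

definition cut :: "real \<Rightarrow> complex set" where "cut t = {z \<in> cell q K u. ht z \<le> t * \<rho>}"

text \<open>Height is affine, so testing the three vertices decides whether the whole subcell lies
  below the line.\<close>

definition below :: "nat \<Rightarrow> real \<Rightarrow> nat list set" where
  "below n t = {v \<in> words n. \<forall>l\<in>{0,1,2}. ht (SGword q (u @ v) (q l)) \<le> t * \<rho>}"

definition below_cells :: "nat \<Rightarrow> real \<Rightarrow> complex set" where
  "below_cells n t = (\<Union>v\<in>below n t. cell q K (u @ v))"

lemma ht_vertex: "l \<in> {0,1,2} \<Longrightarrow> ht (SGword q u (q l)) = (if l = k then 0 else \<rho>)"
  using height by (simp add: ht_def)

lemma ht_le: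
  assumes "z \<in> K" "\<And>l. l \<in> {0,1,2} \<Longrightarrow> ht (SGword q w (q l)) \<le> M" shows "ht (SGword q w z) \<le> M"
proof -
  have "inner (SGword q w z) e \<le> M + inner (SGword q u (q k)) e"
    by (rule inner_SGword_bounds(1)[OF assms(1)]) (use assms(2) in \<open>simp add: ht_def inner_diff_left diff_le_eq del: insert_iff\<close>)
  then show ?thesis by (simp add: ht_def inner_diff_left)
qed

lemma ht_nonneg: assumes "z \<in> cell q K u" shows "0 \<le> ht z"
proof -
  obtain z' where z': "z' \<in> K" "z = SGword q u z'" using assms unfolding cell_def by blast
  have "inner (SGword q u (q k)) e \<le> inner (SGword q u z') e"
  proof (rule inner_SGword_bounds(2)[OF z'(1)])
    fix i :: nat assume "i \<in> {0,1,2}"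
    then have "0 \<le> ht (SGword q u (q i))" using ht_vertex \<rho> by simp
    then show "inner (SGword q u (q k)) e \<le> inner (SGword q u (q i)) e" by (simp add: ht_def inner_diff_left)
  qed
  then show ?thesis by (simp add: z'(2) ht_def inner_diff_left)
qed

lemma continuous_ht: "continuous_on S ht"
  unfolding ht_def by (intro continuous_intros)

lemma sets_cut: "cut t \<in> sets \<mu>"
proof -
  have "cut t = cell q K u \<inter> {z. ht z \<le> t * \<rho>}" by (auto simp: cut_def)
  moreover have "closed {z. ht z \<le> t * \<rho>}" by (intro closed_Collect_le continuous_ht continuous_on_const)
  ultimately show ?thesis unfolding sets_\<mu> by (metis borel_closed closed_Int closed_cell)
qed

lemma cut_subset: "cut t \<subseteq> K"
  using cell_subset_K[OF u] by (auto simp: cut_def)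

lemma finite_below: "finite (below n t)"
  unfolding below_def by (rule finite_subset[OF _ finite_words]) blast

lemma set_below: "v \<in> below n t \<Longrightarrow> set v \<subseteq> {0,1,2}" and length_below: "v \<in> below n t \<Longrightarrow> length v = n"
  by (simp_all add: below_def words_def)

lemma sets_below_cells: "below_cells n t \<in> sets \<mu>"
  unfolding below_cells_def by (intro sets.finite_UN finite_below sets_cell)

lemma below_cells_subset: "below_cells n t \<subseteq> cut t"
proof
  fix z assume "z \<in> below_cells n t"
  then obtain v where v: "v \<in> below n t" "z \<in> cell q K (u @ v)" unfolding below_cells_def by blast
  then have vw: "v \<in> words n" by (simp add: below_def)
  obtain z' where z': "z' \<in> K" "z = SGword q (u @ v) z'" using v(2) unfolding cell_def by blast
  have "ht z \<le> t * \<rho>" unfolding z'(2) by (rule ht_le[OF z'(1)]) (use v(1) in \<open>unfold below_def, blast\<close>)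
  moreover have "z \<in> cell q K u" using cell_words[of u n] v(2) vw by blast
  ultimately show "z \<in> cut t" by (simp add: cut_def)
qed

lemma below_snoc:
  assumes "v \<in> below n t" "a \<in> {0,1,2}" shows "v @ [a] \<in> below (Suc n) t"
proof -
  have "ht (SGword q (u @ v @ [a]) (q l)) \<le> t * \<rho>" if "l \<in> {0,1,2}" for l
  proof -
    have "ht (SGword q (u @ v) (SGmap q a (q l))) \<le> t * \<rho>"
      by (rule ht_le[OF SGmap_K[OF assms(2) q_K[OF that]]]) (use assms(1) in \<open>unfold below_def, blast\<close>)
    then show ?thesis by (simp add: SGword_append)
  qed
  then show ?thesis using assms by (simp add: below_def words_def)
qed

lemma incseq_below_cells: "incseq (\<lambda>n. below_cells n t)"
proof (rule incseq_SucI)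
  fix n
  show "below_cells n t \<subseteq> below_cells (Suc n) t"
  proof
    fix z assume "z \<in> below_cells n t"
    then obtain v where v: "v \<in> below n t" "z \<in> cell q K (u @ v)" unfolding below_cells_def by blast
    obtain a where "a \<in> words (Suc 0)" "z \<in> cell q K ((u @ v) @ a)"
      using v(2) cell_words[of "u @ v" "Suc 0"] by blast
    then obtain b where "b \<in> {0,1,2}" "z \<in> cell q K (u @ (v @ [b]))" by (auto simp: words_Suc)
    then show "z \<in> below_cells (Suc n) t" using below_snoc[OF v(1)] unfolding below_cells_def by blast
  qed
qed

text \<open>Diameters of subcells tend to 0, so a point strictly below the line eventually lies in a
  subcell below it. Strictness matters; points on the line are left to a null set.\<close>

lemma below_cells_exhaust:
  assumes "z \<in> cell q K u" "ht z < t * \<rho>" shows "\<exists>n. z \<in> below_cells n t"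
proof -
  define C where "C = diameter K * norm e"
  have "(\<lambda>n. C / 2 ^ n) \<longlonglongrightarrow> 0" by (rule LIMSEQ_divide_realpow_zero) simp
  then have "\<forall>\<^sub>F n in sequentially. C / 2 ^ n < t * \<rho> - ht z"
    using assms(2) by (intro order_tendstoD(2)) auto
  then obtain n where n: "C / 2 ^ n < t * \<rho> - ht z" unfolding eventually_sequentially by blast
  obtain v where v: "v \<in> words n" "z \<in> cell q K (u @ v)" using assms(1) cell_words[of u n] by blast
  obtain z' where z': "z' \<in> K" "z = SGword q (u @ v) z'" using v(2) unfolding cell_def by blast
  have "ht (SGword q (u @ v) (q l)) \<le> t * \<rho>" if "l \<in> {0,1,2}" for l
  proof -
    have "ht (SGword q (u @ v) (q l)) - ht z = inner (SGword q (u @ v) (q l) - SGword q (u @ v) z') e"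
      by (simp add: ht_def z'(2) inner_diff_left)
    also have "\<dots> \<le> norm (SGword q (u @ v) (q l) - SGword q (u @ v) z') * norm e"
      by (rule norm_cauchy_schwarz)
    also have "norm (SGword q (u @ v) (q l) - SGword q (u @ v) z') = dist (q l) z' / 2 ^ length (u @ v)"
      by (simp only: SGword_diff norm_divide norm_power dist_norm) simp
    also have "\<dots> \<le> diameter K / 2 ^ n"
    proof (rule frac_le)
      show "dist (q l) z' \<le> diameter K"
        by (rule diameter_bounded_bound[OF compact_imp_bounded[OF K_compact] q_K[OF that] z'(1)])
      show "(2::real) ^ n \<le> 2 ^ length (u @ v)" using v(1) by (simp add: words_def)
    qed (auto intro: diameter_ge_0 compact_imp_bounded K_compact)
    finally have "ht (SGword q (u @ v) (q l)) - ht z \<le> C / 2 ^ n" by (simp add: C_def mult_right_mono)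
    then show ?thesis using n by linarith
  qed
  then have "v \<in> below n t" using v(1) by (simp add: below_def)
  then show ?thesis using v(2) unfolding below_cells_def by blast
qed

lemma ht_level_null: "measure \<mu> {z \<in> cell q K u. ht z = c} = 0"
proof -
  obtain l where l: "l \<in> {0,1,2}" "l \<noteq> k" using that[of 0] that[of 1] by (cases "k = 0") auto
  have "inner (SGword q u (q l) - SGword q u (q k)) e \<noteq> 0" using height[OF l(1)] l(2) \<rho> by simp
  moreover have "SGword q u (q l) - SGword q u (q k) = (1 / 2 ^ length u) *\<^sub>R (q l - q k)"
    by (simp add: SGword_diff scaleR_conv_of_real)
  ultimately have "inner (q l) e \<noteq> inner (q k) e" by (auto simp: inner_diff_left)
  from measure_cell_line[OF l(1) k this u, of "c + inner (SGword q u (q k)) e"]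
  have "measure \<mu> (cell q K u \<inter> {z. inner z e = c + inner (SGword q u (q k)) e}) = 0" .
  moreover have "cell q K u \<inter> {z. inner z e = c + inner (SGword q u (q k)) e} = {z \<in> cell q K u. ht z = c}"
    by (auto simp: ht_def inner_diff_left)
  ultimately show ?thesis by simp
qed

lemma sets_ht_level: "{z \<in> cell q K u. ht z = c} \<in> sets \<mu>"
proof -
  have "{z \<in> cell q K u. ht z = c} = cell q K u \<inter> {z. ht z = c}" by auto
  moreover have "closed {z. ht z = c}" by (intro closed_Collect_eq continuous_ht continuous_on_const)
  ultimately show ?thesis unfolding sets_\<mu> by (metis borel_closed closed_Int closed_cell)
qed

lemma AE_below_cells: "AE x in \<mu>. x \<in> (\<Union>n. below_cells n t) \<longleftrightarrow> x \<in> cut t"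
proof (rule AE_I')
  show "{z \<in> cell q K u. ht z = t * \<rho>} \<in> null_sets \<mu>"
    using sets_ht_level ht_level_null by (simp add: null_sets_def emeasure_eq_measure)
  show "{x \<in> space \<mu>. \<not> (x \<in> (\<Union>n. below_cells n t) \<longleftrightarrow> x \<in> cut t)} \<subseteq> {z \<in> cell q K u. ht z = t * \<rho>}"
  proof
    fix x assume "x \<in> {x \<in> space \<mu>. \<not> (x \<in> (\<Union>n. below_cells n t) \<longleftrightarrow> x \<in> cut t)}"
    then have x: "x \<in> cut t" "\<not> (\<exists>n. x \<in> below_cells n t)" using below_cells_subset by blast+
    then show "x \<in> {z \<in> cell q K u. ht z = t * \<rho>}"
      using below_cells_exhaust[of x t] unfolding cut_def by fastforce
  qed
qed

lemma integral_below_cells_tendsto: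
  assumes "continuous_on K (h :: complex \<Rightarrow> real)"
  shows "(\<lambda>n. LINT x:below_cells n t|\<mu>. h x) \<longlonglongrightarrow> (LINT x:cut t|\<mu>. h x)"
proof -
  have m: "(\<Union>n. below_cells n t) \<in> sets \<mu>" using sets_below_cells by blast
  have "(\<Union>n. below_cells n t) \<subseteq> K" using below_cells_subset cut_subset by blast
  then have i: "set_integrable \<mu> (\<Union>n. below_cells n t) h" by (intro set_integrable_K assms m)
  have i': "set_integrable \<mu> (cut t) h" by (intro set_integrable_K assms cut_subset sets_cut)
  have "(LINT x:(\<Union>n. below_cells n t)|\<mu>. h x) = (LINT x:cut t|\<mu>. h x)"
  proof (rule set_integral_cong_set)
    show "set_borel_measurable \<mu> (\<Union>n. below_cells n t) h" "set_borel_measurable \<mu> (cut t) h"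
      using i i' unfolding set_integrable_def set_borel_measurable_def by (simp_all only: borel_measurable_integrable)
    show "AE x in \<mu>. x \<in> cut t \<longleftrightarrow> x \<in> (\<Union>n. below_cells n t)" using AE_below_cells[of t] by eventually_elim blast
  qed
  then show ?thesis using set_integral_cont_up[OF sets_below_cells incseq_below_cells i] by simp
qed

section \<open>Reflection symmetry of a cut\<close>

text \<open>Boundary values of the harmonic function that vanishes at the cut vertex and is 1 at the
  other two.\<close>

definition far :: "nat \<Rightarrow> real" where "far l = (if l = k then 0 else 1)"

definition far_sum :: "nat \<Rightarrow> real \<Rightarrow> real" where
  "far_sum n t = (\<Sum>v\<in>below n t. cell_avg v far) / 3 ^ n"

definition card_sum :: "nat \<Rightarrow> real \<Rightarrow> real" where
  "card_sum n t = card (below n t) / 3 ^ n"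

lemma far_bounds: "0 \<le> cell_avg v far" "cell_avg v far \<le> 1"
  by (rule cell_avg_nonneg cell_avg_le_1; simp add: far_def)+

text \<open>Swapping the two far vertices preserves the vertex heights. Every deeper vertex arises
  by taking midpoints, where the height is the mean, so induction on the address suffices.\<close>

lemma ht_transpose:
  assumes "{k,r,s} = {0,1,2}" "r \<noteq> k" "s \<noteq> k" "set v \<subseteq> {0,1,2}" "l \<in> {0,1,2}"
  shows "ht (SGword q (u @ map (Transposition.transpose r s) v) (q (Transposition.transpose r s l))) = ht (SGword q (u @ v) (q l))"
proof -
  have rs: "r \<in> {0,1,2}" "s \<in> {0,1,2}" using assms(1) by blast+
  have T: "Transposition.transpose r s i \<in> {0,1,2}" if "i \<in> {0,1,2}" for i
    using that rs by (simp add: Transposition.transpose_def del: insert_iff)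
  have vert: "ht (SGword q u (q (Transposition.transpose r s i))) = ht (SGword q u (q i))" if "i \<in> {0,1,2}" for i
    unfolding ht_vertex[OF that] ht_vertex[OF T[OF that]] using assms(2,3) by (simp add: Transposition.transpose_def)
  have mid: "ht (SGword q u ((x + y) / 2)) = (ht (SGword q u x) + ht (SGword q u y)) / 2" for x y
  proof -
    have "SGword q u ((x + y) / 2) - SGword q u (q k) = (1/2) *\<^sub>R ((SGword q u x - SGword q u (q k)) + (SGword q u y - SGword q u (q k)))"
      by (simp add: SGword_mid scaleR_conv_of_real field_simps)
    then show ?thesis unfolding ht_def by (simp only: inner_scaleR_left inner_add_left)
  qed
  have "ht (SGword q u (SGword q (map (Transposition.transpose r s) v) (q (Transposition.transpose r s l)))) = ht (SGword q u (SGword q v (q l)))"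
    using assms(4)
  proof (induction v)
    case Nil
    then show ?case using vert[OF assms(5)] by simp
  next
    case (Cons i v)
    have i: "i \<in> {0,1,2}" "set v \<subseteq> {0,1,2}" using Cons.prems by auto
    show ?case using Cons.IH[OF i(2)] vert[OF i(1)] by (simp add: SGmap_def mid)
  qed
  then show ?thesis by (simp add: SGword_append)
qed

lemma below_transpose:
  assumes "{k,r,s} = {0,1,2}" "r \<noteq> k" "s \<noteq> k" "v \<in> below n t"
  shows "map (Transposition.transpose r s) v \<in> below n t"
proof -
  have rs: "r \<in> {0,1,2}" "s \<in> {0,1,2}" using assms(1) by blast+
  have T: "Transposition.transpose r s i \<in> {0,1,2}" if "i \<in> {0,1,2}" for i
    using that rs by (simp add: Transposition.transpose_def del: insert_iff)
  have "ht (SGword q (u @ map (Transposition.transpose r s) v) (q l)) \<le> t * \<rho>" if l: "l \<in> {0,1,2}" for l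
  proof -
    have "ht (SGword q (u @ map (Transposition.transpose r s) v) (q (Transposition.transpose r s (Transposition.transpose r s l)))) =
        ht (SGword q (u @ v) (q (Transposition.transpose r s l)))"
      by (rule ht_transpose[OF assms(1-3) set_below[OF assms(4)] T[OF l]])
    also have "\<dots> \<le> t * \<rho>" using assms(4) T[OF l] unfolding below_def by blast
    finally show ?thesis by simp
  qed
  moreover have "map (Transposition.transpose r s) v \<in> words n"
  proof -
    have "Transposition.transpose r s i \<in> {0,1,2}" if "i \<in> set v" for i
      by (rule T[OF subsetD[OF set_below[OF assms(4)] that]])
    then have "set (map (Transposition.transpose r s) v) \<subseteq> {0,1,2}"
      unfolding set_map by (rule image_subsetI)
    then show ?thesis using length_below[OF assms(4)] by (simp add: words_def)
  qed
  ultimately show ?thesis by (simp add: below_def)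
qed

text \<open>The reflection of the cell that fixes its vertex of index k permutes the cells below a given
  height, so only the mean of the other two vertex values enters.\<close>
lemma sum_below_cell_avg:
  assumes krs: "{k,r,s} = {0,1,2}" "r \<noteq> k" "s \<noteq> k"
  shows "(\<Sum>v\<in>below n t. cell_avg v x) / 3 ^ n =
    x k * card_sum n t + ((x r + x s) / 2 - x k) * far_sum n t"
proof -
  let ?T = "Transposition.transpose r s"
  have rs: "r \<in> {0,1,2}" "s \<in> {0,1,2}" using assms(1) by blast+
  have "(\<Sum>v\<in>below n t. cell_avg v x) = (\<Sum>v\<in>below n t. cell_avg (map ?T v) x)"
    by (rule sum.reindex_bij_witness[of _ "map ?T" "map ?T"])
      (use below_transpose[OF krs] in \<open>simp_all add: map_idI\<close>)
  also have "\<dots> = (\<Sum>v\<in>below n t. cell_avg v (\<lambda>l. x (?T l)))"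
    by (simp only: cell_avg_transpose[OF rs])
  finally have "2 * (\<Sum>v\<in>below n t. cell_avg v x) =
      (\<Sum>v\<in>below n t. 1 * cell_avg v x + 1 * cell_avg v (\<lambda>l. x (?T l)))"
    by (simp add: sum.distrib)
  also have "\<dots> = (\<Sum>v\<in>below n t. 2 * x k * 1 + (x r + x s - 2 * x k) * cell_avg v far)"
  proof (rule sum.cong[OF refl])
    fix v assume v: "v \<in> below n t"
    have "1 * cell_avg v x + 1 * cell_avg v (\<lambda>l. x (?T l)) = cell_avg v (\<lambda>l. 1 * x l + 1 * x (?T l))"
      by (simp only: cell_avg_linear)
    \<comment> \<open>Boundary values added to their mirror image are symmetric, hence a combination
      of a constant and \<open>far\<close>.\<close>
    also have "\<dots> = cell_avg v (\<lambda>l. 2 * x k * 1 + (x r + x s - 2 * x k) * far l)"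
    proof (rule cell_avg_cong[OF set_below[OF v]])
      fix l :: nat assume "l \<in> {0,1,2}"
      then have "l = k \<or> l = r \<or> l = s" using krs(1) by blast
      then show "1 * x l + 1 * x (?T l) = 2 * x k * 1 + (x r + x s - 2 * x k) * far l"
        using krs(2,3) by (auto simp: far_def Transposition.transpose_def)
    qed
    also have "\<dots> = 2 * x k * 1 + (x r + x s - 2 * x k) * cell_avg v far"
      by (simp only: cell_avg_linear cell_avg_const)
    finally show "1 * cell_avg v x + 1 * cell_avg v (\<lambda>l. x (?T l)) =
      2 * x k * 1 + (x r + x s - 2 * x k) * cell_avg v far" .
  qed
  also have "\<dots> = 2 * x k * card (below n t) + (x r + x s - 2 * x k) * (\<Sum>v\<in>below n t. cell_avg v far)"
    by (simp add: sum.distrib sum_distrib_left)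
  finally have "(\<Sum>v\<in>below n t. cell_avg v x) =
      x k * card (below n t) + ((x r + x s) / 2 - x k) * (\<Sum>v\<in>below n t. cell_avg v far)"
    by (simp add: field_simps)
  then show ?thesis by (simp add: card_sum_def far_sum_def add_divide_distrib)
qed

lemma integral_below_cells:
  assumes "edge_rule h" "{k,r,s} = {0,1,2}" "r \<noteq> k" "s \<noteq> k"
  shows "(LINT x:below_cells n t|\<mu>. h x) =
    (h (SGword q u (q k)) * card_sum n t
      + ((h (SGword q u (q r)) + h (SGword q u (q s))) / 2 - h (SGword q u (q k))) * far_sum n t) / 3 ^ length u"
proof -
  have c: "continuous_on K h" using assms(1) by (simp add: edge_rule_def)
  have "(LINT x:below_cells n t|\<mu>. h x) = (\<Sum>v\<in>below n t. LINT x:cell q K (u @ v)|\<mu>. h x)"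
    unfolding below_cells_def by (rule integral_subcells[OF c u, of _ n]) (auto simp: below_def)
  also have "\<dots> = (\<Sum>v\<in>below n t. cell_avg v (\<lambda>l. h (SGword q u (q l))) / 3 ^ n / 3 ^ length u)"
  proof (rule sum.cong[OF refl])
    fix v assume v: "v \<in> below n t"
    have "set (u @ v) \<subseteq> {0,1,2}" using u set_below[OF v] by simp
    then have "(LINT x:cell q K (u @ v)|\<mu>. h x) = vertex_avg h (u @ v) / 3 ^ length (u @ v)"
      by (rule integral_cell[OF assms(1)])
    also have "\<dots> = cell_avg v (\<lambda>l. h (SGword q u (q l))) / 3 ^ length (u @ v)"
      by (simp only: vertex_avg_append[OF assms(1) u set_below[OF v]])
    finally show "(LINT x:cell q K (u @ v)|\<mu>. h x) = cell_avg v (\<lambda>l. h (SGword q u (q l))) / 3 ^ n / 3 ^ length u"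
      using length_below[OF v] by (simp add: power_add mult.commute)
  qed
  also have "\<dots> = (\<Sum>v\<in>below n t. cell_avg v (\<lambda>l. h (SGword q u (q l)))) / 3 ^ n / 3 ^ length u"
    by (simp only: sum_divide_distrib)
  also have "\<dots> = (h (SGword q u (q k)) * card_sum n t
      + ((h (SGword q u (q r)) + h (SGword q u (q s))) / 2 - h (SGword q u (q k))) * far_sum n t) / 3 ^ length u"
    by (simp only: sum_below_cell_avg[OF assms(2-4)])
  finally show ?thesis .
qed

end

context gasket_cut
begin

section \<open>Mass and far mass as functions of the cutting height\<close>

text \<open>Convergence is proved in \<open>far_sum_tendsto\<close>. The normalisation is that of
  \<open>mass\<close>: the full cell counts as 1.\<close>

definition far_mass :: "real \<Rightarrow> real" where "far_mass t = lim (\<lambda>n. far_sum n t)"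

definition mass :: "real \<Rightarrow> real" where "mass t = 3 ^ length u * measure \<mu> (cut t)"

lemma far_sum_le_card_sum: "far_sum n t \<le> card_sum n t"
proof -
  have "(\<Sum>v\<in>below n t. cell_avg v far) \<le> (\<Sum>v\<in>below n t. 1)"
    by (intro sum_mono far_bounds)
  then show ?thesis unfolding far_sum_def card_sum_def by (intro divide_right_mono) auto
qed

lemma far_sum_nonneg: "0 \<le> far_sum n t"
  unfolding far_sum_def by (intro divide_nonneg_nonneg sum_nonneg far_bounds) simp

lemma card_sum_le_1: "card_sum n t \<le> 1"
proof -
  have "card (below n t) \<le> card (words n)"
    by (rule card_mono) (auto simp: below_def)
  then have "real (card (below n t)) \<le> real (3 ^ n)" unfolding card_words by (simp only: of_nat_le_iff)
  then show ?thesis unfolding card_sum_def by simp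
qed

text \<open>Children of a cell below the line are below it and reproduce its contribution by
  \<open>cell_avg_snoc\<close>; further cells contribute nonnegative terms.\<close>

lemma far_sum_Suc: "far_sum n t \<le> far_sum (Suc n) t"
proof -
  let ?S = "below n t \<times> {0,1,2}"
  have "3 * (\<Sum>v\<in>below n t. cell_avg v far) = (\<Sum>v\<in>below n t. \<Sum>a\<in>{0,1,2}. cell_avg (v @ [a]) far)"
    by (simp only: sum_distrib_left cell_avg_snoc)
  also have "\<dots> = (\<Sum>(v,a)\<in>?S. cell_avg (v @ [a]) far)"
    by (rule sum.cartesian_product)
  also have "\<dots> = (\<Sum>v\<in>(\<lambda>(v,a). v @ [a]) ` ?S. cell_avg v far)"
  proof (rule sum.reindex_cong[symmetric])
    show "inj_on (\<lambda>(v,a). v @ [a]) ?S" by (rule inj_onI) (simp add: case_prod_beta prod_eq_iff)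
    show "(\<lambda>(v,a). v @ [a]) ` ?S = (\<lambda>(v,a). v @ [a]) ` ?S" ..
  qed (simp add: case_prod_beta)
  also have "\<dots> \<le> (\<Sum>v\<in>below (Suc n) t. cell_avg v far)"
  proof (rule sum_mono2[OF finite_below])
    show "(\<lambda>(v,a). v @ [a]) ` ?S \<subseteq> below (Suc n) t"
      by (rule image_subsetI) (simp add: case_prod_beta mem_Times_iff below_snoc del: insert_iff)
  qed (rule far_bounds)
  finally show ?thesis unfolding far_sum_def by (simp add: field_simps)
qed

lemma far_sum_tendsto: "(\<lambda>n. far_sum n t) \<longlonglongrightarrow> far_mass t"
proof -
  have i: "incseq (\<lambda>n. far_sum n t)" by (rule incseq_SucI) (rule far_sum_Suc)
  have "\<forall>n. far_sum n t \<le> 1" using far_sum_le_card_sum card_sum_le_1 order_trans by blast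
  from incseq_convergent[OF i this] obtain L where "(\<lambda>n. far_sum n t) \<longlonglongrightarrow> L" by blast
  then show ?thesis unfolding far_mass_def by (simp add: limI)
qed

lemma integral_cut_one: "(LINT x:cut t|\<mu>. 1) = measure \<mu> (cut t)"
  using set_integral_const[OF sets_cut, of t "1::real"] by (simp add: emeasure_eq_measure)

lemma other_vertices: obtains r s where "{k,r,s} = {0,1,2}" "r \<noteq> k" "s \<noteq> k" "r \<noteq> s"
proof -
  have "k = 0 \<or> k = 1 \<or> k = 2" using k by simp
  then show ?thesis using that[of 1 2] that[of 0 2] that[of 0 1] by (elim disjE) (simp_all add: insert_commute)
qed

text \<open>Take the integral formula for the constant function 1: its vertex values agree, so the
  \<open>far_sum\<close> term drops out.\<close>

lemma card_sum_tendsto: "(\<lambda>n. card_sum n t) \<longlonglongrightarrow> mass t"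
proof -
  obtain r s where rs: "{k,r,s} = {0,1,2}" "r \<noteq> k" "s \<noteq> k" "r \<noteq> s" by (rule other_vertices)
  have "(\<lambda>n. LINT x:below_cells n t|\<mu>. 1) \<longlonglongrightarrow> measure \<mu> (cut t)"
    using integral_below_cells_tendsto[of "\<lambda>_. 1" t] by (simp add: integral_cut_one)
  moreover have "(LINT x:below_cells n t|\<mu>. 1) = card_sum n t / 3 ^ length u" for n
    using integral_below_cells[OF edge_rule_one rs(1-3), of n t] by simp
  ultimately have "(\<lambda>n. 3 ^ length u * (card_sum n t / 3 ^ length u)) \<longlonglongrightarrow> 3 ^ length u * measure \<mu> (cut t)"
    by (intro tendsto_mult_left) simp
  then show ?thesis by (simp add: mass_def)
qed

lemma integral_cut:
  assumes "edge_rule h" "{k,r,s} = {0,1,2}" "r \<noteq> k" "s \<noteq> k"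
  shows "(LINT x:cut t|\<mu>. h x) =
    (h (SGword q u (q k)) * mass t
      + ((h (SGword q u (q r)) + h (SGword q u (q s))) / 2 - h (SGword q u (q k))) * far_mass t) / 3 ^ length u"
proof (rule LIMSEQ_unique)
  have "continuous_on K h" using assms(1) by (simp add: edge_rule_def)
  then show "(\<lambda>n. LINT x:below_cells n t|\<mu>. h x) \<longlonglongrightarrow> (LINT x:cut t|\<mu>. h x)"
    by (rule integral_below_cells_tendsto)
  show "(\<lambda>n. LINT x:below_cells n t|\<mu>. h x) \<longlonglongrightarrow> (h (SGword q u (q k)) * mass t
      + ((h (SGword q u (q r)) + h (SGword q u (q s))) / 2 - h (SGword q u (q k))) * far_mass t) / 3 ^ length u"
    unfolding integral_below_cells[OF assms]
    by (intro tendsto_intros card_sum_tendsto far_sum_tendsto) simp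
qed

lemma measure_cut: "measure \<mu> (cut t) = mass t / 3 ^ length u"
  by (simp add: mass_def)

text \<open>Raising the line adds cells, each with an average of \<open>far\<close> between 0 and 1.
  So increments of \<open>far_mass\<close> are nonnegative and dominated by those of
  \<open>mass\<close>; monotonicity of both, and continuity of \<open>far_mass\<close> from that of
  \<open>mass\<close>, follow.\<close>

lemma far_mass_mono:
  assumes "t \<le> t'"
  shows "0 \<le> far_mass t' - far_mass t" "far_mass t' - far_mass t \<le> mass t' - mass t"
proof -
  have sub: "below n t \<subseteq> below n t'" for n
  proof -
    have "t * \<rho> \<le> t' * \<rho>" using assms \<rho> by (simp add: mult_right_mono)
    then show ?thesis unfolding below_def by (auto simp del: insert_iff intro: order_trans)
  qed
  have diff: "(\<Sum>v\<in>below n t'. f v) - (\<Sum>v\<in>below n t. f v) = (\<Sum>v\<in>below n t' - below n t. f v)"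
    for n and f :: "nat list \<Rightarrow> real"
    by (rule sum_diff[OF finite_below sub, symmetric])
  have "far_sum n t' - far_sum n t = (\<Sum>v\<in>below n t' - below n t. cell_avg v far) / 3 ^ n" for n
    unfolding far_sum_def by (simp only: diff diff_divide_distrib[symmetric])
  moreover have "card_sum n t' - card_sum n t = (\<Sum>v\<in>below n t' - below n t. 1) / 3 ^ n" for n
    unfolding card_sum_def by (simp only: diff[of "\<lambda>_. 1", symmetric] diff_divide_distrib[symmetric] real_of_card)
  moreover have "(\<Sum>v\<in>below n t' - below n t. cell_avg v far) / 3 ^ n \<le> (\<Sum>v\<in>below n t' - below n t. 1) / 3 ^ n" for n
    by (intro divide_right_mono sum_mono far_bounds) simp
  moreover have "0 \<le> (\<Sum>v\<in>below n t' - below n t. cell_avg v far) / 3 ^ n" for n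
    by (intro divide_nonneg_nonneg sum_nonneg far_bounds) simp
  ultimately have b: "0 \<le> far_sum n t' - far_sum n t" "far_sum n t' - far_sum n t \<le> card_sum n t' - card_sum n t" for n
    by simp_all
  have l: "(\<lambda>n. far_sum n t' - far_sum n t) \<longlonglongrightarrow> far_mass t' - far_mass t"
    by (intro tendsto_diff far_sum_tendsto)
  show "0 \<le> far_mass t' - far_mass t" by (rule LIMSEQ_le_const[OF l]) (use b(1) in blast)
  have l': "(\<lambda>n. card_sum n t' - card_sum n t) \<longlonglongrightarrow> mass t' - mass t"
    by (intro tendsto_diff card_sum_tendsto)
  show "far_mass t' - far_mass t \<le> mass t' - mass t" by (rule LIMSEQ_le[OF l l']) (use b(2) in blast)
qed

lemma mass_mono: "mono mass"
proof
  fix t t' :: real assume "t \<le> t'"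
  from far_mass_mono[OF this] show "mass t \<le> mass t'" by linarith
qed

lemma mass_0: "mass 0 = 0"
proof -
  have "cut 0 = {z \<in> cell q K u. ht z = 0}"
    unfolding cut_def using ht_nonneg by fastforce
  then show ?thesis using ht_level_null[of 0] by (simp add: mass_def)
qed

lemma far_mass_nonneg: "0 \<le> far_mass t"
  by (rule LIMSEQ_le_const[OF far_sum_tendsto]) (use far_sum_nonneg in blast)

lemma far_mass_0: "far_mass 0 = 0"
proof -
  have "far_mass 0 \<le> mass 0"
    by (rule LIMSEQ_le[OF far_sum_tendsto card_sum_tendsto]) (use far_sum_le_card_sum in blast)
  then show ?thesis using far_mass_nonneg[of 0] mass_0 by simp
qed

lemma ht_le_1: assumes "z \<in> K" shows "ht (SGword q u z) \<le> \<rho>"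
  by (rule ht_le[OF assms]) (simp only: ht_vertex, use \<rho> in simp)

lemma mass_1: "mass 1 = 1"
proof -
  have "cut 1 = cell q K u" unfolding cut_def cell_def using ht_le_1 by auto
  then show ?thesis using measure_cell[OF u] by (simp add: mass_def)
qed

lemma below_1: "below n 1 = words n"
proof -
  have "ht (SGword q (u @ v) (q l)) \<le> 1 * \<rho>" if "v \<in> words n" "l \<in> {0,1,2}" for v l
  proof -
    have "SGword q v (q l) \<in> K" using that by (intro SGword_K q_K) (auto simp: words_def)
    then show ?thesis using ht_le_1 by (simp add: SGword_append)
  qed
  then show ?thesis unfolding below_def by blast
qed

text \<open>At full height every subcell is counted, so the sums are constant in \<open>n\<close>
  and equal the mean of 0, 1, 1.\<close>

lemma far_mass_1: "far_mass 1 = 2/3"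
proof -
  have "cell_avg [] far = 2/3" using k by (auto simp: far_def)
  then have e: "far_sum n 1 = 2/3" for n
    unfolding far_sum_def below_1 cell_avg_words by simp
  have "(\<lambda>n. 2/3) \<longlonglongrightarrow> far_mass 1" using far_sum_tendsto[of 1] unfolding e .
  then show ?thesis by (simp add: LIMSEQ_const_iff)
qed

text \<open>Up to scaling, \<open>mass\<close> is on [0,1] the distribution function of the
  normalised height, which has no atoms there because level lines are null.\<close>

lemma continuous_mass: "continuous_on {0..1} mass"
proof -
  \<comment> \<open>The value 2 outside the cell lies above every \<open>t\<close> in [0,1], so
    those points are never counted.\<close>
  define g where "g z = (if z \<in> cell q K u then ht z / \<rho> else 2)" for z
  have ht: "ht \<in> borel_measurable borel"
    by (rule borel_measurable_continuous_onI[OF continuous_ht])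
  have "g \<in> borel_measurable borel"
    unfolding g_def
  proof (rule measurable_If_set)
    show "cell q K u \<inter> space borel \<in> sets borel" using sets_cell by simp
    show "(\<lambda>z. ht z / \<rho>) \<in> borel_measurable borel"
      by (intro borel_measurable_divide borel_measurable_const ht)
  qed (rule borel_measurable_const)
  then have g: "random_variable borel g" by (simp add: measurable_cong_sets[OF sets_\<mu> refl])
  define M where "M = distr \<mu> borel g"
  interpret M: real_distribution M unfolding M_def by (rule real_distribution_distr[OF g])
  have vimage: "measure M A = measure \<mu> (g -` A)" if "A \<in> sets borel" for A
    unfolding M_def by (subst measure_distr[OF g that]) simp
  have cdf: "cdf M t = measure \<mu> (cut t)" if "t \<in> {0..1}" for t
  proof -
    have "g -` {..t} = cut t" using that \<rho> by (auto simp: g_def cut_def divide_le_eq split: if_splits)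
    then show ?thesis by (simp add: cdf_def vimage)
  qed
  have "isCont (cdf M) t" if "t \<in> {0..1}" for t
  proof -
    have "g -` {t} = {z \<in> cell q K u. ht z = t * \<rho>}" using that \<rho> by (auto simp: g_def divide_eq_eq split: if_splits)
    then have "measure M {t} = 0" by (simp add: vimage ht_level_null)
    then show ?thesis by (simp add: M.isCont_cdf)
  qed
  then have "continuous_on {0..1} (cdf M)" by (intro continuous_at_imp_continuous_on) blast
  then have "continuous_on {0..1} (\<lambda>t. 3 ^ length u * cdf M t)" by (intro continuous_intros)
  then show ?thesis
    by (rule continuous_on_eq) (simp add: cdf mass_def)
qed

lemma continuous_far_mass: "continuous_on {0..1} far_mass"
proof -
  have *: "\<bar>far_mass x - far_mass y\<bar> \<le> \<bar>mass x - mass y\<bar>" for x y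
    using far_mass_mono[of x y] far_mass_mono[of y x] by linarith
  show ?thesis
    unfolding continuous_on_iff
  proof (intro ballI allI impI)
    fix x e :: real assume "x \<in> {0..1}" "e > 0"
    then obtain d where d: "d > 0" "\<forall>y\<in>{0..1}. dist y x < d \<longrightarrow> dist (mass y) (mass x) < e"
      using continuous_mass unfolding continuous_on_iff by blast
    show "\<exists>d>0. \<forall>y\<in>{0..1}. dist y x < d \<longrightarrow> dist (far_mass y) (far_mass x) < e"
      using d * unfolding dist_real_def by (meson le_less_trans)
  qed
qed

end

context gasket
begin

text \<open>All cells are translated and scaled copies of one triangle, so only the level matters.
  The centroid has distance side / sqrt 3 from a vertex, and the inner product side^2 / 2 with the
  unnormalised axis becomes the height sqrt 3 / 2 * side.\<close>

lemma cell_height_cut: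
  assumes "k \<in> {0,1,2}" "l \<in> {0,1,2}" "length u = length w"
  shows "inner (SGword q u (q l) - SGword q u (q k)) (sgn (cell_centroid q u - SGword q u (q k)))
    = (if l = k then 0 else cell_height q w)"
proof -
  let ?N = "2 ^ length w :: real"
  have qd: "SGword q u (q l) - SGword q u (q k) = (1 / ?N) *\<^sub>R (q l - q k)"
    by (simp add: SGword_diff assms(3) scaleR_conv_of_real)
  have "cell_centroid q u - SGword q u (q k) =
      ((SGword q u (q 0) - SGword q u (q k)) + (SGword q u (q 1) - SGword q u (q k)) + (SGword q u (q 2) - SGword q u (q k))) / 3"
    by (simp add: cell_centroid_def field_simps)
  also have "\<dots> = (1 / ?N) *\<^sub>R (ctr - q k)"
    unfolding SGword_diff by (simp add: assms(3) scaleR_conv_of_real ctr_def field_simps)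
  finally have c: "cell_centroid q u - SGword q u (q k) = (1 / ?N) *\<^sub>R (ctr - q k)" .
  have "norm (ctr - q k)^2 = (side / sqrt 3)^2"
    using inner_q[OF assms(1,1)] by (simp add: power2_norm_eq_inner power_divide norm_minus_commute[of ctr])
  then have n: "norm (ctr - q k) = side / sqrt 3" using side_pos by (simp add: power2_eq_iff_nonneg)
  have s: "sgn (cell_centroid q u - SGword q u (q k)) = (sqrt 3 / side) *\<^sub>R (ctr - q k)"
    unfolding c by (simp add: sgn_scaleR sgn_div_norm n)
  have i: "inner (q l - q k) (ctr - q k) = (if l = k then 0 else side\<^sup>2 / 2)"
  proof -
    have "inner (q l - q k) (ctr - q k) = inner (q k - ctr) (q k - ctr) - inner (q l - ctr) (q k - ctr)"
      by (simp add: inner_diff_left inner_diff_right inner_commute)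
    then show ?thesis using inner_q[OF assms(1,1)] inner_q[OF assms(2,1)] by simp
  qed
  have "dist (SGword q w (q 0)) (SGword q w (q 1)) = side / ?N"
    by (simp add: dist_norm SGword_diff norm_divide norm_power side_def)
  then have h: "cell_height q w = sqrt 3 / 2 * (side / ?N)" by (simp add: cell_height_def)
  show ?thesis unfolding qd s h inner_scaleR_left inner_scaleR_right i
    using side_pos by (simp add: power2_eq_square)
qed

lemma cell_height_pos: "cell_height q w > 0"
proof -
  have "SGword q w (q 0) \<noteq> SGword q w (q 1)" using q01 by simp
  then show ?thesis by (simp add: cell_height_def)
qed

end

section \<open>The mean value property\<close>

theorem theorem3p1:
  fixes q :: "nat \<Rightarrow> complex" and K :: "complex set" and \<mu> :: "complex measure"
    and w :: "nat list" and v :: "nat \<Rightarrow> nat list" and a :: "nat \<Rightarrow> real"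
  assumes equilateral: "q 0 \<noteq> q 1" "dist (q 0) (q 1) = dist (q 1) (q 2)"
      "dist (q 1) (q 2) = dist (q 2) (q 0)"
    and SG: "is_SG q K"
    and meas: "is_SG_measure q K \<mu>"
    and w: "set w \<subseteq> {0,1,2}" "cell q K w \<inter> V0 q = {}"
    and v: "\<forall>i\<in>{0,1,2}. set (v i) \<subseteq> {0,1,2} \<and> length (v i) = length w \<and> v i \<noteq> w
              \<and> SGword q w (q i) \<in> cell q K (v i)"
    and a: "\<forall>i\<in>{0,1,2}. a i \<ge> 0" "a 0 + a 1 + a 2 = 1"
  shows "\<exists>c. (\<forall>i\<in>{0,1,2}. c i \<in> {0..1}) \<and>
           (\<forall>h. harmonic_SG q K h \<longrightarrow>
              mean_on \<mu> (Bset q K w v c) h = (\<Sum>i\<in>{0,1,2}. a i * h (SGword q w (q i))))"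
proof -
  interpret gasket_measure q K \<mu>
    using equilateral SG meas by unfold_locales
  define p where "p i = SGword q w (q i)" for i
  have vi: "set (v i) \<subseteq> {0,1,2}" "length (v i) = length w" "v i \<noteq> w" "p i \<in> cell q K (v i)"
    if "i \<in> {0,1,2}" for i
    using v that unfolding p_def by blast+
  \<comment> \<open>The point p_i is a vertex of the neighbouring cell too; its index
    \<open>k i\<close> there is kept separate from its index \<open>i\<close> in C_w.\<close>
  have "\<exists>k. k \<in> {0,1,2} \<and> p i = SGword q (v i) (q k)" if i: "i \<in> {0,1,2}" for i
  proof -
    obtain z where z: "z \<in> K" "p i = SGword q (v i) z" using vi(4)[OF i] unfolding cell_def by blast
    have "\<exists>k\<in>{0,1,2}. z = q k"
      by (rule SGword_overlap_vertex[OF vi(1)[OF i] w(1) vi(2,3)[OF i] z(1) q_K[OF i]])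
        (use z(2) in \<open>simp add: p_def\<close>)
    then show ?thesis using z(2) by blast
  qed
  then obtain k where k: "k i \<in> {0,1,2}" "p i = SGword q (v i) (q (k i))" if "i \<in> {0,1,2}" for i
    by metis
  define e where "e i = sgn (cell_centroid q (v i) - p i)" for i
  have cut_loc: "gasket_cut q K \<mu> (v i) (k i) (e i) (cell_height q w)" if i: "i \<in> {0,1,2}" for i
  proof
    show "set (v i) \<subseteq> {0,1,2}" by (rule vi(1)[OF i])
    show "k i \<in> {0,1,2}" by (rule k(1)[OF i])
    show "0 < cell_height q w" by (rule cell_height_pos)
    show "inner (SGword q (v i) (q l) - SGword q (v i) (q (k i))) (e i) = (if l = k i then 0 else cell_height q w)"
      if "l \<in> {0,1,2}" for l
      unfolding e_def k(2)[OF i] by (rule cell_height_cut[OF k(1)[OF i] that vi(2)[OF i]])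
  qed
  define m where "m i = gasket_cut.mass q K \<mu> (v i) (k i) (e i) (cell_height q w)" for i
  define \<beta> where "\<beta> i = gasket_cut.far_mass q (v i) (k i) (e i) (cell_height q w)" for i
  have E: "Ecut q K w (v i) i t = gasket_cut.cut q K (v i) (k i) (e i) (cell_height q w) t"
    if i: "i \<in> {0,1,2}" for i t
    unfolding gasket_cut.cut_def[OF cut_loc[OF i]] gasket_cut.ht_def[OF cut_loc[OF i]]
    unfolding Ecut_def Let_def e_def k(2)[OF i, symmetric] p_def ..
  have "\<exists>c. (\<forall>i\<in>{0,1,2}. c i \<in> {0..1}) \<and> (\<forall>i\<in>{0,1,2}. a i * (1 + (\<Sum>j\<in>{0,1,2}. m j (c j))) =
    1/3 + m i (c i) + 3/2 * \<beta> i (c i) - (\<Sum>j\<in>{0,1,2}. \<beta> j (c j)) / 2)"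
  proof (rule balance_three[OF _ _ _ _ _ _ _ _ a])
    fix i :: nat assume i: "i \<in> {0,1,2}"
    note loc = cut_loc[OF i]
    show "continuous_on {0..1} (m i)" unfolding m_def by (rule gasket_cut.continuous_mass[OF loc])
    show "continuous_on {0..1} (\<beta> i)" unfolding \<beta>_def by (rule gasket_cut.continuous_far_mass[OF loc])
    show "mono_on {0..1} (m i)" unfolding m_def
      by (rule mono_on_subset[OF gasket_cut.mass_mono[OF loc]]) simp
    show "mono_on {0..1} (\<beta> i)" unfolding \<beta>_def
      by (rule mono_onI) (use gasket_cut.far_mass_mono(1)[OF loc] in simp)
    show "m i 0 = 0" "m i 1 = 1" "\<beta> i 0 = 0" "\<beta> i 1 = 2/3"
      unfolding m_def \<beta>_def
      by (rule gasket_cut.mass_0[OF loc] gasket_cut.mass_1[OF loc]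
          gasket_cut.far_mass_0[OF loc] gasket_cut.far_mass_1[OF loc])+
  qed
  then obtain c where c: "\<forall>i\<in>{0,1,2}. c i \<in> {0..1}"
    and bal: "\<And>i. i \<in> {0,1,2} \<Longrightarrow> a i * (1 + (\<Sum>j\<in>{0,1,2}. m j (c j))) =
      1/3 + m i (c i) + 3/2 * \<beta> i (c i) - (\<Sum>j\<in>{0,1,2}. \<beta> j (c j)) / 2"
    by blast
  define A where "A i = Ecut q K w (v i) i (c i)" for i
  have A_sets: "A i \<in> sets \<mu>" and A_sub: "A i \<subseteq> cell q K (v i)" if i: "i \<in> {0,1,2}" for i
    using gasket_cut.sets_cut[OF cut_loc[OF i]] unfolding A_def E[OF i]
    by (auto simp: gasket_cut.cut_def[OF cut_loc[OF i]])
  have disj0: "AE x in \<mu>. \<not> (x \<in> cell q K w \<and> x \<in> A i)" if i: "i \<in> {0,1,2}" for i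
    using AE_cells_disjoint[OF w(1) vi(1)[OF i] vi(2)[OF i, symmetric] vi(3)[OF i, symmetric]]
    by eventually_elim (use A_sub[OF i] in blast)
  \<comment> \<open>If two neighbours coincided, that cell would meet C_w in two different
    points.\<close>
  have v_ne: "v i \<noteq> v j" if ij: "i \<in> {0,1,2}" "j \<in> {0,1,2}" "i \<noteq> j" for i j
  proof
    assume eq: "v i = v j"
    have "q i = q j"
      by (rule SGword_overlap_unique[OF w(1) vi(1)[OF ij(1)] vi(2)[OF ij(1), symmetric] vi(3)[OF ij(1), symmetric]
            q_K[OF ij(1)] q_K[OF k(1)[OF ij(1)]] _ q_K[OF ij(2)] q_K[OF k(1)[OF ij(2)]]])
        (use k(2)[OF ij(1)] k(2)[OF ij(2)] eq in \<open>simp_all add: p_def\<close>)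
    then show False using q_inj[OF ij(1,2)] ij(3) by simp
  qed
  have disj: "AE x in \<mu>. \<not> (x \<in> A i \<and> x \<in> A j)" if ij: "i \<in> {0,1,2}" "j \<in> {0,1,2}" "i \<noteq> j" for i j
  proof -
    have "AE x in \<mu>. \<not> (x \<in> cell q K (v i) \<and> x \<in> cell q K (v j))"
      by (rule AE_cells_disjoint[OF vi(1)[OF ij(1)] vi(1)[OF ij(2)] _ v_ne[OF ij]])
        (simp only: vi(2)[OF ij(1)] vi(2)[OF ij(2)])
    then show ?thesis by eventually_elim (use A_sub[OF ij(1)] A_sub[OF ij(2)] in blast)
  qed
  have int_B: "(LINT x:Bset q K w v c|\<mu>. h x) = (LINT x:cell q K w|\<mu>. h x) + (\<Sum>i\<in>{0,1,2}. LINT x:A i|\<mu>. h x)"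
    if h: "continuous_on K h" for h :: "complex \<Rightarrow> real"
  proof -
    have iA: "set_integrable \<mu> (A i) h" if i: "i \<in> {0,1,2}" for i
      by (rule set_integrable_subset[OF set_integrable_cell[OF h vi(1)[OF i]] A_sets[OF i] A_sub[OF i]])
    have "AE x in \<mu>. \<forall>i\<in>{0,1,2}. \<not> (x \<in> cell q K w \<and> x \<in> A i)"
      by (rule AE_finite_allI[OF _ disj0]) simp
    then have AE: "AE x in \<mu>. \<not> (x \<in> cell q K w \<and> x \<in> (\<Union>i\<in>{0,1,2}. A i))"
      by eventually_elim blast
    have "(LINT x:Bset q K w v c|\<mu>. h x) = (LINT x:cell q K w|\<mu>. h x) + (LINT x:(\<Union>i\<in>{0,1,2}. A i)|\<mu>. h x)"
      unfolding Bset_def A_def[symmetric]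
    proof (rule set_integral_Un_AE[OF AE sets_cell _ set_integrable_cell[OF h w(1)]])
      show "(\<Union>i\<in>{0,1,2}. A i) \<in> sets \<mu>" by (rule sets.finite_UN[OF _ A_sets]) simp
      show "set_integrable \<mu> (\<Union>i\<in>{0,1,2}. A i) h" by (rule set_integrable_UN[OF _ iA A_sets]) simp_all
    qed
    also have "(LINT x:(\<Union>i\<in>{0,1,2}. A i)|\<mu>. h x) = (\<Sum>i\<in>{0,1,2}. LINT x:A i|\<mu>. h x)"
      by (rule set_integral_finite_UN_AE[OF _ A_sets iA disj]) simp_all
    finally show ?thesis .
  qed
  have B_sets: "Bset q K w v c \<in> sets \<mu>"
    unfolding Bset_def A_def[symmetric] by (intro sets.Un sets.finite_UN sets_cell A_sets) simp_all
  have meas_B: "3 ^ length w * measure \<mu> (Bset q K w v c) = 1 + (\<Sum>i\<in>{0,1,2}. m i (c i))"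
  proof -
    have one: "(LINT x:S|\<mu>. 1) = measure \<mu> S" if "S \<in> sets \<mu>" for S
      using set_integral_const[OF that, of "1::real"] by (simp add: emeasure_eq_measure)
    have "measure \<mu> (Bset q K w v c) = (LINT x:Bset q K w v c|\<mu>. 1)"
      by (rule one[OF B_sets, symmetric])
    also have "\<dots> = (LINT x:cell q K w|\<mu>. 1) + (\<Sum>i\<in>{0,1,2}. LINT x:A i|\<mu>. 1)"
      by (rule int_B) (rule continuous_on_const)
    also have "\<dots> = 1 / 3 ^ length w + (\<Sum>i\<in>{0,1,2}. m i (c i) / 3 ^ length w)"
    proof (rule arg_cong2[where f = "(+)"])
      show "(LINT x:cell q K w|\<mu>. 1) = (1 / 3 ^ length w :: real)"
        unfolding one[OF sets_cell] by (rule measure_cell[OF w(1)])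
      show "(\<Sum>i\<in>{0,1,2}. LINT x:A i|\<mu>. 1) = (\<Sum>i\<in>{0,1,2}. m i (c i) / 3 ^ length w)"
      proof (rule sum.cong[OF refl])
        fix i :: nat assume i: "i \<in> {0,1,2}"
        show "(LINT x:A i|\<mu>. 1) = m i (c i) / 3 ^ length w"
          unfolding one[OF A_sets[OF i]] unfolding A_def E[OF i] m_def
          using gasket_cut.measure_cut[OF cut_loc[OF i]] vi(2)[OF i] by simp
      qed
    qed
    also have "\<dots> = (1 + (\<Sum>i\<in>{0,1,2}. m i (c i))) / 3 ^ length w"
      by (simp only: add_divide_distrib sum_divide_distrib)
    finally show ?thesis by simp
  qed
  have m_nonneg: "0 \<le> m i (c i)" if i: "i \<in> {0,1,2}" for i
    unfolding m_def gasket_cut.mass_def[OF cut_loc[OF i]] by simp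
  have mean: "mean_on \<mu> (Bset q K w v c) h = (\<Sum>i\<in>{0,1,2}. a i * h (p i))" if h: "harmonic_SG q K h" for h
  proof -
    have er: "edge_rule h" by (rule harmonic_edge_rule[OF h])
    have cont: "continuous_on K h" using er by (simp add: edge_rule_def)
    let ?S = "\<Sum>i\<in>{0,1,2}. h (p i)"
    have intA: "(LINT x:A i|\<mu>. h x) = (h (p i) * m i (c i) + (3 * h (p i) - ?S) / 2 * \<beta> i (c i)) / 3 ^ length w"
      if i: "i \<in> {0,1,2}" for i
    proof -
      obtain r s where rs: "{k i, r, s} = {0,1,2}" "r \<noteq> k i" "s \<noteq> k i" "r \<noteq> s"
        by (rule gasket_cut.other_vertices[OF cut_loc[OF i]])
      \<comment> \<open>Harmonicity is available at p_i because the cell avoids the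
        boundary.\<close>
      have "p i \<notin> V0 q"
        using w(2) q_K[OF i] unfolding p_def cell_def by blast
      then have "6 * h (p i) = ?S + (\<Sum>l\<in>{0,1,2}. h (SGword q (v i) (q l)))"
        unfolding p_def
        by (intro harmonic_two_cells[OF h _ _ vi(3)[OF i, symmetric] i k(1)[OF i]])
          (use w(1) vi(1,2)[OF i] k(2)[OF i] in \<open>simp_all add: words_def p_def\<close>)
      also have "(\<Sum>l\<in>{0,1,2}. h (SGword q (v i) (q l))) =
          h (p i) + h (SGword q (v i) (q r)) + h (SGword q (v i) (q s))"
        unfolding rs(1)[symmetric] k(2)[OF i] using rs(2-4) by simp
      \<comment> \<open>Harmonicity at p_i replaces the unknown far values by the three values on
        C_w; this is the origin of the coefficients 3/2 and 1/2.\<close>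
      finally have "(h (SGword q (v i) (q r)) + h (SGword q (v i) (q s))) / 2 - h (p i) = (3 * h (p i) - ?S) / 2"
        by (simp add: field_simps)
      then show ?thesis
        using gasket_cut.integral_cut[OF cut_loc[OF i] er rs(1-3), of "c i"]
        unfolding A_def E[OF i] m_def[symmetric] \<beta>_def[symmetric] k(2)[OF i, symmetric] vi(2)[OF i] by simp
    qed
    have "3 ^ length w * (LINT x:Bset q K w v c|\<mu>. h x) =
        ?S / 3 + (\<Sum>i\<in>{0,1,2}. h (p i) * m i (c i) + (3 * h (p i) - ?S) / 2 * \<beta> i (c i))"
    proof -
      let ?N = "3 ^ length w :: real" and ?X = "\<Sum>i\<in>{0,1,2}. h (p i) * m i (c i) + (3 * h (p i) - ?S) / 2 * \<beta> i (c i)"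
      have "(\<Sum>i\<in>{0,1,2}. LINT x:A i|\<mu>. h x) = ?X / ?N"
        unfolding sum_divide_distrib by (rule sum.cong[OF refl intA])
      moreover have "(LINT x:cell q K w|\<mu>. h x) = ?S / 3 / ?N"
        unfolding integral_cell[OF er w(1)] vertex_avg_def p_def ..
      ultimately have "(LINT x:Bset q K w v c|\<mu>. h x) = (?S / 3 + ?X) / ?N"
        by (simp only: int_B[OF cont] add_divide_distrib)
      then show ?thesis by (simp only:) simp
    qed
    \<comment> \<open>Collecting coefficients: \<open>?S\<close> contains every h(p_i), so each one
      picks up 1/3 from C_w and minus half of the sum of all far masses.\<close>
    also have "\<dots> = (\<Sum>i\<in>{0,1,2}. (1/3 + m i (c i) + 3/2 * \<beta> i (c i) - (\<Sum>j\<in>{0,1,2}. \<beta> j (c j)) / 2) * h (p i))"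
      by (simp add: algebra_simps add_divide_distrib diff_divide_distrib)
    also have "\<dots> = (\<Sum>i\<in>{0,1,2}. (a i * h (p i)) * (1 + (\<Sum>j\<in>{0,1,2}. m j (c j))))"
    proof (rule sum.cong[OF refl])
      fix i :: nat assume i: "i \<in> {0,1,2}"
      show "(1/3 + m i (c i) + 3/2 * \<beta> i (c i) - (\<Sum>j\<in>{0,1,2}. \<beta> j (c j)) / 2) * h (p i) =
          (a i * h (p i)) * (1 + (\<Sum>j\<in>{0,1,2}. m j (c j)))"
        unfolding bal[OF i, symmetric] by (simp only: mult_ac)
    qed
    also have "\<dots> = (\<Sum>i\<in>{0,1,2}. a i * h (p i)) * (3 ^ length w * measure \<mu> (Bset q K w v c))"
      unfolding meas_B by (rule sum_distrib_right[symmetric])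
    finally have "(LINT x:Bset q K w v c|\<mu>. h x) = (\<Sum>i\<in>{0,1,2}. a i * h (p i)) * measure \<mu> (Bset q K w v c)"
      by simp
    \<comment> \<open>The normalised mass is at least the 1 contributed by C_w, which permits the
      division in \<open>mean_on\<close>.\<close>
    moreover have "measure \<mu> (Bset q K w v c) \<noteq> 0"
    proof
      assume "measure \<mu> (Bset q K w v c) = 0"
      then have "1 + (\<Sum>i\<in>{0,1,2}. m i (c i)) = 0" using meas_B by simp
      moreover have "0 \<le> (\<Sum>i\<in>{0,1,2}. m i (c i))" by (rule sum_nonneg[OF m_nonneg])
      ultimately show False by linarith
    qed
    ultimately show ?thesis unfolding mean_on_def by simp
  qed
  show ?thesis using c mean unfolding p_def by blast
qed

end
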